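(* For each $n$, consider an $n\times n$ input-queued switch, starting empty, in which the arrival processes to the $n^2$ queues are independent Bernoulli processes with common rate $\rho/n$ per time slot, where $\rho = 1 - 1/n$. Then there is a constant $c$, not depending on $n$, such that for every $n$ there exists a scheduling policy under which $$\sum_{i,j=1}^n \mathbb{E}[Q_{i,j}(\tau)] \le c\, n^{2.5} \log n \qquad \text{for all } \tau\in\{1,2,\dots\}.$$
   Context: **Input-queued switch.** An $n\times n$ input-queued switch operates in discrete time slots $\tau\in\{1,2,\dots\}$ and has one queue for each pair $(i,j)$, $1\le i,j\le n$ (packets at input port $i$ destined for output port $j$). $A_{i,j}(\tau)$ is the cumulative number of packets arriving to queue $(i,j)$ during slots $1,\dots,\tau$, with $A_{i,j}(0)=0$. The processes $A_{i,j}(\cdot)$ are independent across $(i,j)$, and for each $(i,j)$ the increments $A_{i,j}(\tau)-A_{i,j}(\tau-1)$, $\tau\ge 1$, are i.i.d. Bernoulli with parameter $\rho/n$. **Schedules and policies.** The set of feasible schedules is $$\mathcal S=\Big\{\sigma\in\{0,1\}^{n\times n}: \sum_k\sigma_{i,k}\le 1,\ \sum_k\sigma_{k,j}\le 1\ \text{ for all } i,j\Big\}.$$ A scheduling policy is a rule that at each time $\tau$ chooses a schedule $\sigma(\tau)\in\mathcal S$ based on the past history and the current queue sizes $Q_{i,j}(\tau)$. The policy may depend on $n$ and $\rho$. **Dynamics.** $Q_{i,j}(\tau)$ is the number of packets in queue $(i,j)$ at the beginning of slot $\tau$. The system starts empty, $Q_{i,j}(1)=0$ for all $i,j$, and service precedes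 the arrivals of the slot: $$Q_{i,j}(\tau+1)=Q_{i,j}(\tau)-\sigma_{i,j}(\tau)\mathbf 1_{\{Q_{i,j}(\tau)>0\}}+A_{i,j}(\tau)-A_{i,j}(\tau-1).$$ $\log$ is the natural logarithm. *)

theory Defs
  imports "HOL-Probability.Probability"
begin

text \<open>
  An \<open>n \<times> n\<close> matrix is a function on ports \<open>1, \<dots>, n\<close>. Queue, schedule and arrival matrices
  all vanish outside \<open>{1..n} \<times> {1..n}\<close>, so they carry no information besides their \<open>n\<^sup>2\<close> entries.
\<close>

type_synonym port_matrix = "nat \<Rightarrow> nat \<Rightarrow> nat"

text \<open>The queue sizes, the schedule and the new arrivals of one past slot.\<close>

type_synonym slot_record = "port_matrix \<times> port_matrix \<times> port_matrix"

text \<open>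
  A policy maps the records of slots \<open>1, \<dots>, \<tau> - 1\<close> (in this order) and the current queue sizes
  \<open>Q(\<tau>)\<close> to the schedule \<open>\<sigma>(\<tau>)\<close>. The time \<open>\<tau>\<close> is one plus the length of the history.
\<close>

type_synonym policy = "slot_record list \<Rightarrow> port_matrix \<Rightarrow> port_matrix"

definition schedules :: "nat \<Rightarrow> port_matrix set" where
  "schedules n = {\<sigma>.
     (\<forall>i j. \<sigma> i j \<in> {0, 1}) \<and>
     (\<forall>i j. i \<notin> {1..n} \<or> j \<notin> {1..n} \<longrightarrow> \<sigma> i j = 0) \<and>
     (\<forall>i\<in>{1..n}. (\<Sum>k=1..n. \<sigma> i k) \<le> 1) \<and>
     (\<forall>j\<in>{1..n}. (\<Sum>k=1..n. \<sigma> k j) \<le> 1)}"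

definition scheduling_policy :: "nat \<Rightarrow> policy \<Rightarrow> bool" where
  "scheduling_policy n \<pi> \<longleftrightarrow> (\<forall>h q. \<pi> h q \<in> schedules n)"

text \<open>
  In the following, \<open>a i j \<tau>\<close> is one sample path of the cumulative arrivals to queue \<open>(i, j)\<close>.
\<close>

definition new_arrivals :: "nat \<Rightarrow> (nat \<Rightarrow> nat \<Rightarrow> nat \<Rightarrow> nat) \<Rightarrow> nat \<Rightarrow> port_matrix" where
  "new_arrivals n a \<tau> = (\<lambda>i j. if i \<in> {1..n} \<and> j \<in> {1..n} then a i j \<tau> - a i j (\<tau> - 1) else 0)"

text \<open>
  \<open>switch_run n \<pi> a k\<close> is the history and the queue matrix at the beginning of slot \<open>k + 1\<close>.
\<close>

primrec switch_run ::
    "nat \<Rightarrow> policy \<Rightarrow> (nat \<Rightarrow> nat \<Rightarrow> nat \<Rightarrow> nat) \<Rightarrow> nat \<Rightarrow> slot_record list \<times> port_matrix" where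
  "switch_run n \<pi> a 0 = ([], \<lambda>i j. 0)"
| "switch_run n \<pi> a (Suc k) =
     (let (h, q) = switch_run n \<pi> a k; \<sigma> = \<pi> h q; d = new_arrivals n a (Suc k)
      in (h @ [(q, \<sigma>, d)],
          \<lambda>i j. q i j - (if q i j > 0 then \<sigma> i j else 0) + d i j))"

definition queue ::
    "nat \<Rightarrow> policy \<Rightarrow> (nat \<Rightarrow> nat \<Rightarrow> nat \<Rightarrow> nat) \<Rightarrow> nat \<Rightarrow> port_matrix" where
  "queue n \<pi> a \<tau> = snd (switch_run n \<pi> a (\<tau> - 1))"

definition schedule ::
    "nat \<Rightarrow> policy \<Rightarrow> (nat \<Rightarrow> nat \<Rightarrow> nat \<Rightarrow> nat) \<Rightarrow> nat \<Rightarrow> port_matrix" where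
  "schedule n \<pi> a \<tau> = \<pi> (fst (switch_run n \<pi> a (\<tau> - 1))) (queue n \<pi> a \<tau>)"

text \<open>
  The next three facts are the equations of the switch dynamics for slots
  \<open>\<tau> = 1, 2, \<dots>\<close>; the last one is stated in the integers, where subtraction is not truncated.
\<close>

lemma queue_1: "queue n \<pi> a 1 i j = 0"
  by (simp add: queue_def)

lemma schedule_eq:
  assumes "\<tau> \<ge> 1"
  shows "schedule n \<pi> a \<tau> =
    \<pi> (map (\<lambda>s. (queue n \<pi> a s, schedule n \<pi> a s, new_arrivals n a s)) [1..<\<tau>]) (queue n \<pi> a \<tau>)"
proof -
  have "fst (switch_run n \<pi> a k) =
      map (\<lambda>s. (queue n \<pi> a s, schedule n \<pi> a s, new_arrivals n a s)) [1..<Suc k]" for k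
    by (induction k) (simp_all add: queue_def schedule_def Let_def case_prod_beta)
  from this[of "\<tau> - 1"] assms show ?thesis
    by (simp add: schedule_def)
qed

lemma queue_Suc:
  assumes "scheduling_policy n \<pi>" and "\<tau> \<ge> 1" and "i \<in> {1..n}" and "j \<in> {1..n}" and "mono (a i j)"
  shows "int (queue n \<pi> a (\<tau> + 1) i j) =
    int (queue n \<pi> a \<tau> i j) - int (schedule n \<pi> a \<tau> i j) * of_bool (queue n \<pi> a \<tau> i j > 0)
      + int (a i j \<tau>) - int (a i j (\<tau> - 1))"
proof -
  obtain k where k: "\<tau> = Suc k"
    using assms(2) by (cases \<tau>) auto
  have le: "a i j k \<le> a i j (Suc k)"
    using assms(5) by (simp add: monoD)
  have "schedule n \<pi> a \<tau> \<in> schedules n"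
    using assms(1) by (simp add: schedule_def scheduling_policy_def)
  then have "schedule n \<pi> a \<tau> i j \<in> {0, 1}"
    unfolding schedules_def by blast
  then show ?thesis
    using assms(3,4) le
    by (auto simp: k queue_def schedule_def new_arrivals_def Let_def case_prod_beta)
qed

text \<open>
  \<open>A i j \<tau>\<close> is the random number of packets that arrive to queue \<open>(i, j)\<close> in slots \<open>1, \<dots>, \<tau>\<close>.
  Being counts, the paths are nondecreasing, so the subtraction in the increments is exact.
  Independence across queues is that of whole processes, as random elements of the space of
  sequences.
\<close>

definition bernoulli_arrivals ::
    "'w measure \<Rightarrow> nat \<Rightarrow> real \<Rightarrow> (nat \<Rightarrow> nat \<Rightarrow> nat \<Rightarrow> 'w \<Rightarrow> nat) \<Rightarrow> bool" where
  "bernoulli_arrivals M n \<rho> A \<longleftrightarrow>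
     prob_space M \<and>
     (\<forall>i\<in>{1..n}. \<forall>j\<in>{1..n}. \<forall>\<omega>\<in>space M. A i j 0 \<omega> = 0 \<and> mono (\<lambda>\<tau>. A i j \<tau> \<omega>)) \<and>
     prob_space.indep_vars M (\<lambda>_. \<Pi>\<^sub>M \<tau>\<in>UNIV. count_space UNIV)
       (\<lambda>(i, j) \<omega> \<tau>. A i j \<tau> \<omega>) ({1..n} \<times> {1..n}) \<and>
     (\<forall>i\<in>{1..n}. \<forall>j\<in>{1..n}.
        prob_space.indep_vars M (\<lambda>_. count_space UNIV)
          (\<lambda>\<tau> \<omega>. A i j \<tau> \<omega> - A i j (\<tau> - 1) \<omega>) {1..} \<and>
        (\<forall>\<tau>\<ge>1. distr M (count_space UNIV) (\<lambda>\<omega>. A i j \<tau> \<omega> - A i j (\<tau> - 1) \<omega>) =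
           measure_pmf (map_pmf of_bool (bernoulli_pmf (\<rho> / real n)))))"

end

(*
  Time is cut into batches of length b of order n^2 log n. Batch k is served from d slots after its
  start, d being of order n^(3/2) log n, to d slots after its end: first in round-robin order, each
  queue once every n slots, while the batch is still arriving, and during the last d slots by an
  optimal clearing of what is left. The head start of d slots exceeds the fluctuations of every
  queue, so with high probability no round-robin service is wasted; then every row and column of
  the leftover matrix sums to at most d - n, because the arrivals to a port during a batch fall
  short of b by order b / n, which exceeds their fluctuations. By Koenig's theorem d schedules clear
  the leftovers plus one additional packet per queue.

  A bad batch (a polynomially rare event depending on its own arrivals only) adds at most b packets
  per queue to a backlog that loses one packet per queue in each batch; this backlog is a random
  walk with negative drift, whose mean is controlled by an exponential moment. Outside the
  backlog the mean total queue size is at most 2 n d, of order n^(5/2) log n.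
*)

theory Submission
  imports Defs
begin

section \<open>Matchings in matrices with bounded line sums\<close>

text \<open>The exponent 5/2 comes from two variance estimates. With load 1 - 1/n a port receives b
  (1 - 1/n) packets per batch on average, with deviations of order sqrt (b log n); the shortfall b /
  n dominates only once b is of order n^2 log n. Over such a batch one queue receives about b / n,
  that is n log n packets, up to a deviation of order sqrt n * log n, and round robin outpaces its
  arrivals by a further b / n^2, that is log n packets. A head start of d slots supplies d / n
  packets, which forces d / n to be of order sqrt n * log n. Round robin offers n services per slot
  against at most n mean arrivals, so the total content keeps the order n d at which it starts.

  The analysis does not follow the queue sizes on bad batches. One scalar, common to all queues and
  computed from the arrivals alone, absorbs their effect; the failure of a batch is then independent
  of the backlog before it.\<close>

lemma hall_marriage:
  assumes "finite I" and "\<And>i. i \<in> I \<Longrightarrow> finite (S i)"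
    and "\<And>J. J \<subseteq> I \<Longrightarrow> card J \<le> card (\<Union>i\<in>J. S i)"
  shows "\<exists>f. inj_on f I \<and> (\<forall>i\<in>I. f i \<in> S i)"
  using assms
proof (induction I arbitrary: S rule: finite_psubset_induct)
  case (psubset I)
  note fin = psubset.prems(1) and hall = psubset.prems(2)
  show ?case
  \<comment> \<open>Induction in the manner of Halmos and Vaughan. A proper nonempty critical set
    \<open>J\<close> is matched into its own neighbourhood, and the rest keeps Hall's condition once
    that neighbourhood is removed. If no set is critical, every proper nonempty set has a spare
    neighbour, so one pair can be fixed arbitrarily.\<close>
  proof (cases "\<exists>J. J \<subset> I \<and> J \<noteq> {} \<and> card (\<Union>i\<in>J. S i) = card J")
    case True
    then obtain J where J: "J \<subset> I" "J \<noteq> {}" "card (\<Union>i\<in>J. S i) = card J" by blast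
    let ?U = "\<Union>i\<in>J. S i"
    have finJ: "finite J" using J(1) psubset.hyps finite_subset by blast
    have finU: "finite ?U" using J(1) fin finJ by blast
    have "\<exists>f. inj_on f J \<and> (\<forall>i\<in>J. f i \<in> S i)"
      by (rule psubset.IH) (use J(1) fin hall in auto)
    then obtain f where f: "inj_on f J" "\<forall>i\<in>J. f i \<in> S i" by blast
    have "\<exists>g. inj_on g (I - J) \<and> (\<forall>i\<in>I - J. g i \<in> S i - ?U)"
    proof (rule psubset.IH)
      show "I - J \<subset> I" using J by blast
      show "finite (S i - ?U)" if "i \<in> I - J" for i using fin that by blast
      fix K assume K: "K \<subseteq> I - J"
      have finK: "finite K" using K psubset.hyps finite_subset by blast
      have eq: "(\<Union>i\<in>K \<union> J. S i) = (\<Union>i\<in>K. S i - ?U) \<union> ?U" by blast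
      have "card K + card J = card (K \<union> J)"
        using K finK finJ by (subst card_Un_disjoint) auto
      also have "\<dots> \<le> card (\<Union>i\<in>K \<union> J. S i)" using hall[of "K \<union> J"] K J(1) by blast
      also have "\<dots> \<le> card (\<Union>i\<in>K. S i - ?U) + card ?U"
        unfolding eq by (rule card_Un_le)
      finally show "card K \<le> card (\<Union>i\<in>K. S i - ?U)" using J(3) by simp
    qed
    then obtain g where g: "inj_on g (I - J)" "\<forall>i\<in>I - J. g i \<in> S i - ?U" by blast
    define h where "h = (\<lambda>i. if i \<in> J then f i else g i)"
    have "f ` J \<subseteq> ?U" using f(2) by (intro image_subsetI UN_I) auto
    moreover have "g ` (I - J) \<inter> ?U = {}" using g(2) by auto
    ultimately have "f ` J \<inter> g ` (I - J) = {}" by blast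
    then have "inj_on h (J \<union> (I - J))"
      unfolding h_def by (rule inj_on_disjoint_Un[OF f(1) g(1)])
    then have "inj_on h I" using J(1) by (simp add: Un_absorb1 psubset_imp_subset)
    moreover have "\<forall>i\<in>I. h i \<in> S i" using f g by (auto simp: h_def)
    ultimately show ?thesis by blast
  next
    case noncritical: False
    show ?thesis
    proof (cases "I = {}")
      case True then show ?thesis by auto
    next
      case nonempty: False
      then obtain i where i: "i \<in> I" by blast
      have "card {i} \<le> card (S i)" using hall[of "{i}"] i by simp
      then obtain x where x: "x \<in> S i" by fastforce
      have "\<exists>g. inj_on g (I - {i}) \<and> (\<forall>k\<in>I - {i}. g k \<in> S k - {x})"
      proof (rule psubset.IH)
        show "I - {i} \<subset> I" using i by blast
        show "finite (S k - {x})" if "k \<in> I - {i}" for k using fin that by blast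
        fix K assume K: "K \<subseteq> I - {i}"
        show "card K \<le> card (\<Union>k\<in>K. S k - {x})"
        proof (cases "K = {}")
          case False
          have finK: "finite K" using K psubset.hyps finite_subset by blast
          have "K \<subset> I" using K i by blast
          then have "card K < card (\<Union>k\<in>K. S k)"
            using hall[of K] False noncritical by (metis le_neq_implies_less psubset_imp_subset)
          moreover have "(\<Union>k\<in>K. S k - {x}) = (\<Union>k\<in>K. S k) - {x}" by blast
          ultimately show ?thesis by (auto simp: card_Diff_singleton_if)
        qed simp
      qed
      then obtain g where g: "inj_on g (I - {i})" "\<forall>k\<in>I - {i}. g k \<in> S k - {x}" by blast
      have "x \<notin> g ` (I - {i})" using g(2) by blast
      then have "inj_on (g(i := x)) (I - {i})" "x \<notin> (g(i := x)) ` (I - {i})"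
        using inj_on_fun_updI[OF g(1)] by simp_all
      then have "inj_on (g(i := x)) (insert i (I - {i}))" by (subst inj_on_insert) simp
      then have "inj_on (g(i := x)) I" using i by (simp add: insert_absorb)
      moreover have "\<forall>k\<in>I. (g(i := x)) k \<in> S k" using g x by auto
      ultimately show ?thesis by blast
    qed
  qed
qed

text \<open>Double counting gives Hall's condition for the positive entries: the rows in
  \<open>J\<close> have total weight \<open>card J * Suc d\<close>, all of it in the columns of
  their neighbourhood, which hold \<open>Suc d\<close> each. The line sum is a successor so that
  this factor can be cancelled.\<close>

lemma regular_matrix_permutation:
  fixes M :: port_matrix
  assumes row: "\<And>i. i \<in> {1..n} \<Longrightarrow> (\<Sum>j=1..n. M i j) = Suc d"
    and col: "\<And>j. j \<in> {1..n} \<Longrightarrow> (\<Sum>i=1..n. M i j) = Suc d"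
  shows "\<exists>f. bij_betw f {1..n} {1..n} \<and> (\<forall>i\<in>{1..n}. M i (f i) > 0)"
proof -
  define S where "S i = {j\<in>{1..n}. M i j > 0}" for i
  have "\<exists>f. inj_on f {1..n} \<and> (\<forall>i\<in>{1..n}. f i \<in> S i)"
  proof (rule hall_marriage)
    fix J assume J: "J \<subseteq> {1..n}"
    let ?U = "\<Union>i\<in>J. S i"
    have U: "?U \<subseteq> {1..n}" by (auto simp: S_def)
    have finJ: "finite J" using J finite_subset by blast
    have "card J * Suc d = (\<Sum>i\<in>J. \<Sum>j=1..n. M i j)"
      using row J by (simp add: subset_iff)
    also have "\<dots> = (\<Sum>i\<in>J. \<Sum>j\<in>?U. M i j)"
      by (intro sum.cong refl sum.mono_neutral_right) (use U in \<open>auto simp: S_def\<close>)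
    also have "\<dots> \<le> (\<Sum>i=1..n. \<Sum>j\<in>?U. M i j)"
      by (rule sum_mono2) (use J in auto)
    also have "\<dots> = (\<Sum>j\<in>?U. \<Sum>i=1..n. M i j)" by (rule sum.swap)
    also have "\<dots> = (\<Sum>j\<in>?U. Suc d)" by (intro sum.cong refl col) (use U in blast)
    also have "\<dots> = card ?U * Suc d" by simp
    finally show "card J \<le> card ?U" by (metis mult_le_cancel2 zero_less_Suc)
  qed (auto simp: S_def)
  then obtain f where f: "inj_on f {1..n}" "\<forall>i\<in>{1..n}. f i \<in> S i" by blast
  then have "f ` {1..n} = {1..n}"
    by (intro endo_inj_surj) (auto simp: S_def)
  with f show ?thesis by (auto simp: bij_betw_def S_def)
qed

section \<open>Decomposition of integer matrices into schedules\<close>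

definition permutation_schedule :: "nat \<Rightarrow> (nat \<Rightarrow> nat) \<Rightarrow> port_matrix" where
  "permutation_schedule n f = (\<lambda>i j. if i \<in> {1..n} \<and> j = f i then 1 else 0)"

lemma permutation_schedule:
  assumes f: "bij_betw f {1..n} {1..n}"
  shows "permutation_schedule n f \<in> schedules n"
    and "i \<in> {1..n} \<Longrightarrow> (\<Sum>j=1..n. permutation_schedule n f i j) = 1"
    and "j \<in> {1..n} \<Longrightarrow> (\<Sum>i=1..n. permutation_schedule n f i j) = 1"
proof -
  let ?\<sigma> = "permutation_schedule n f"
  show row: "(\<Sum>j=1..n. ?\<sigma> i j) = 1" if i: "i \<in> {1..n}" for i
  proof -
    have "f i \<in> {1..n}" using f i by (meson bij_betwE)
    then show ?thesis using i by (simp add: permutation_schedule_def)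
  qed
  show col: "(\<Sum>i=1..n. ?\<sigma> i j) = 1" if j: "j \<in> {1..n}" for j
  proof -
    obtain i where i: "i \<in> {1..n}" "f i = j" using f j by (metis bij_betw_def imageE)
    have "?\<sigma> k j = (if k = i then 1 else 0)" if "k \<in> {1..n}" for k
    proof -
      have "j = f k \<longleftrightarrow> k = i"
        using inj_on_eq_iff[OF bij_betw_imp_inj_on[OF f] that i(1)] i(2) by metis
      then show ?thesis using that by (simp add: permutation_schedule_def)
    qed
    then have "(\<Sum>k=1..n. ?\<sigma> k j) = (\<Sum>k=1..n. if k = i then 1 else 0)"
      by (intro sum.cong) auto
    then show ?thesis using i by simp
  qed
  show "?\<sigma> \<in> schedules n"
    unfolding schedules_def mem_Collect_eq
  proof (intro conjI allI impI ballI)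
    fix i j :: nat
    show "?\<sigma> i j \<in> {0, 1}" by (simp add: permutation_schedule_def)
    show "?\<sigma> i j = 0" if "i \<notin> {1..n} \<or> j \<notin> {1..n}"
      using that bij_betw_apply[OF f, of i] unfolding permutation_schedule_def by auto
    show "(\<Sum>j=1..n. ?\<sigma> i j) \<le> 1" if "i \<in> {1..n}" using row[OF that] by simp
    show "(\<Sum>i=1..n. ?\<sigma> i j) \<le> 1" if "j \<in> {1..n}" using col[OF that] by simp
  qed
qed

text \<open>Integral form of the Birkhoff-von Neumann theorem: peeling off a permutation supported
  on positive entries lowers every line sum by exactly one.\<close>

lemma regular_matrix_decomposition:
  fixes M :: port_matrix
  assumes "\<And>i. i \<in> {1..n} \<Longrightarrow> (\<Sum>j=1..n. M i j) = d"
    and "\<And>j. j \<in> {1..n} \<Longrightarrow> (\<Sum>i=1..n. M i j) = d"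
  shows "\<exists>\<sigma>. (\<forall>u. \<sigma> u \<in> schedules n) \<and> (\<forall>i\<in>{1..n}. \<forall>j\<in>{1..n}. M i j = (\<Sum>u<d. \<sigma> u i j))"
  using assms
proof (induction d arbitrary: M)
  case 0
  have "(\<lambda>i j. 0) \<in> schedules n" by (simp add: schedules_def)
  with 0 show ?case by (intro exI[of _ "\<lambda>u i j. 0"]) auto
next
  case (Suc d)
  obtain f where f: "bij_betw f {1..n} {1..n}" "\<forall>i\<in>{1..n}. M i (f i) > 0"
    using regular_matrix_permutation[OF Suc.prems] by blast
  define \<rho> where "\<rho> = permutation_schedule n f"
  note \<rho> = permutation_schedule[OF f(1), folded \<rho>_def]
  have le: "\<rho> i j \<le> M i j" if "i \<in> {1..n}" for i j
    using f(2) that by (auto simp: \<rho>_def permutation_schedule_def Suc_le_eq)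
  have "\<exists>\<sigma>. (\<forall>u. \<sigma> u \<in> schedules n) \<and>
      (\<forall>i\<in>{1..n}. \<forall>j\<in>{1..n}. M i j - \<rho> i j = (\<Sum>u<d. \<sigma> u i j))"
  proof (rule Suc.IH)
    show "(\<Sum>j=1..n. M i j - \<rho> i j) = d" if "i \<in> {1..n}" for i
      using Suc.prems(1)[OF that] \<rho>(2)[OF that] le[OF that] by (subst sum_subtractf_nat) simp_all
    show "(\<Sum>i=1..n. M i j - \<rho> i j) = d" if "j \<in> {1..n}" for j
      using Suc.prems(2)[OF that] \<rho>(3)[OF that] le by (subst sum_subtractf_nat) simp_all
  qed
  then obtain \<sigma> where \<sigma>: "\<forall>u. \<sigma> u \<in> schedules n"
      "\<forall>i\<in>{1..n}. \<forall>j\<in>{1..n}. M i j - \<rho> i j = (\<Sum>u<d. \<sigma> u i j)" by blast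
  show ?case
  proof (intro exI[of _ "\<sigma>(d := \<rho>)"] conjI ballI allI)
    show "(\<sigma>(d := \<rho>)) u \<in> schedules n" for u using \<sigma> \<rho>(1) by simp
    fix i j assume "i \<in> {1..n}" "j \<in> {1..n}"
    then show "M i j = (\<Sum>u<Suc d. (\<sigma>(d := \<rho>)) u i j)"
      using \<sigma>(2) le[of i j] by (simp flip: \<sigma>(2))
  qed
qed

text \<open>Row sums and column sums have the same grand total. As soon as one line is deficient
  this total is below \<open>n * d\<close>, and then both a deficient row and a deficient column
  exist. Raising the entry where they cross violates no bound and brings the total closer to
  \<open>n * d\<close>.\<close>

lemma complete_to_regular_matrix:
  fixes M :: port_matrix
  assumes "\<And>i. i \<in> {1..n} \<Longrightarrow> (\<Sum>j=1..n. M i j) \<le> d"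
    and "\<And>j. j \<in> {1..n} \<Longrightarrow> (\<Sum>i=1..n. M i j) \<le> d"
  shows "\<exists>M'. (\<forall>i j. M i j \<le> M' i j) \<and> (\<forall>i\<in>{1..n}. (\<Sum>j=1..n. M' i j) = d) \<and>
    (\<forall>j\<in>{1..n}. (\<Sum>i=1..n. M' i j) = d)"
  using assms
proof (induction "n * d - (\<Sum>i=1..n. \<Sum>j=1..n. M i j)" arbitrary: M rule: less_induct)
  case less
  note row = less.prems(1) and col = less.prems(2)
  have tot: "(\<Sum>i=1..n. \<Sum>j=1..n. M i j) = (\<Sum>j=1..n. \<Sum>i=1..n. M i j)" by (rule sum.swap)
  show ?case
  proof (cases "(\<exists>i\<in>{1..n}. (\<Sum>j=1..n. M i j) < d) \<or> (\<exists>j\<in>{1..n}. (\<Sum>i=1..n. M i j) < d)")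
    case False
    then show ?thesis using row col by (intro exI[of _ M]) (auto simp: not_less le_antisym)
  next
    case True
    have "(\<Sum>i=1..n. \<Sum>j=1..n. M i j) < (\<Sum>i=1..n. d)"
    proof (cases "\<exists>i\<in>{1..n}. (\<Sum>j=1..n. M i j) < d")
      case True then show ?thesis using row by (intro sum_strict_mono_ex1) auto
    next
      case False
      with True have "\<exists>j\<in>{1..n}. (\<Sum>i=1..n. M i j) < d" by blast
      then show ?thesis unfolding tot using col by (intro sum_strict_mono_ex1) auto
    qed
    then have lt: "(\<Sum>i=1..n. \<Sum>j=1..n. M i j) < n * d" by simp
    have "\<exists>i\<in>{1..n}. (\<Sum>j=1..n. M i j) < d"
    proof (rule ccontr)
      assume "\<not> ?thesis"
      then have "(\<Sum>i=1..n. d) \<le> (\<Sum>i=1..n. \<Sum>j=1..n. M i j)" by (intro sum_mono) (auto simp: not_less)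
      with lt show False by simp
    qed
    then obtain i0 where i0: "i0 \<in> {1..n}" "(\<Sum>j=1..n. M i0 j) < d" by blast
    have "\<exists>j\<in>{1..n}. (\<Sum>i=1..n. M i j) < d"
    proof (rule ccontr)
      assume "\<not> ?thesis"
      then have "(\<Sum>j=1..n. d) \<le> (\<Sum>j=1..n. \<Sum>i=1..n. M i j)" by (intro sum_mono) (auto simp: not_less)
      with lt show False unfolding tot by simp
    qed
    then obtain j0 where j0: "j0 \<in> {1..n}" "(\<Sum>i=1..n. M i j0) < d" by blast
    define M1 where "M1 i j = M i j + of_bool (i = i0 \<and> j = j0)" for i j
    have M1row: "(\<Sum>j=1..n. M1 i j) = (\<Sum>j=1..n. M i j) + of_bool (i = i0)" for i
      using j0(1) by (cases "i = i0") (auto simp: M1_def sum.distrib of_bool_def)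
    have M1col: "(\<Sum>i=1..n. M1 i j) = (\<Sum>i=1..n. M i j) + of_bool (j = j0)" for j
      using i0(1) by (cases "j = j0") (auto simp: M1_def sum.distrib of_bool_def)
    have M1tot: "(\<Sum>i=1..n. \<Sum>j=1..n. M1 i j) = Suc (\<Sum>i=1..n. \<Sum>j=1..n. M i j)"
      using i0(1) by (simp only: M1row sum.distrib) (simp add: of_bool_def)
    have "\<exists>M'. (\<forall>i j. M1 i j \<le> M' i j) \<and> (\<forall>i\<in>{1..n}. (\<Sum>j=1..n. M' i j) = d) \<and>
        (\<forall>j\<in>{1..n}. (\<Sum>i=1..n. M' i j) = d)"
    proof (rule less.hyps)
      show "n * d - (\<Sum>i=1..n. \<Sum>j=1..n. M1 i j) < n * d - (\<Sum>i=1..n. \<Sum>j=1..n. M i j)"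
        unfolding M1tot using lt by linarith
      show "(\<Sum>j=1..n. M1 i j) \<le> d" if "i \<in> {1..n}" for i
        using row[OF that] i0(2) by (simp only: M1row) (simp add: of_bool_def)
      show "(\<Sum>i=1..n. M1 i j) \<le> d" if "j \<in> {1..n}" for j
        using col[OF that] j0(2) by (simp only: M1col) (simp add: of_bool_def)
    qed
    then obtain M' where M': "\<And>i j. M1 i j \<le> M' i j" "\<forall>i\<in>{1..n}. (\<Sum>j=1..n. M' i j) = d"
        "\<forall>j\<in>{1..n}. (\<Sum>i=1..n. M' i j) = d" by blast
    have "M i j \<le> M' i j" for i j
      using M'(1)[of i j] by (simp add: M1_def)
    with M'(2,3) show ?thesis by blast
  qed
qed

text \<open>Koenig's edge-colouring theorem for the bipartite multigraph with \<open>M i j\<close>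
  parallel edges. A covering is enough for scheduling, so the dummy edges of the completion are
  simply kept.\<close>

lemma koenig_schedules:
  fixes M :: port_matrix
  assumes "\<And>i. i \<in> {1..n} \<Longrightarrow> (\<Sum>j=1..n. M i j) \<le> d"
    and "\<And>j. j \<in> {1..n} \<Longrightarrow> (\<Sum>i=1..n. M i j) \<le> d"
  shows "\<exists>\<sigma>. (\<forall>u. \<sigma> u \<in> schedules n) \<and> (\<forall>i\<in>{1..n}. \<forall>j\<in>{1..n}. M i j \<le> (\<Sum>u<d. \<sigma> u i j))"
proof -
  obtain M' where M': "\<forall>i j. M i j \<le> M' i j" "\<forall>i\<in>{1..n}. (\<Sum>j=1..n. M' i j) = d"
      "\<forall>j\<in>{1..n}. (\<Sum>i=1..n. M' i j) = d"
    using complete_to_regular_matrix[of n M d, OF assms] by blast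
  with regular_matrix_decomposition[of n M' d] show ?thesis by metis
qed

section \<open>The batching policy along a sample path\<close>

text \<open>Time is counted in elapsed slots: the interval from \<open>s\<close> to \<open>t\<close>
  comprises the slots \<open>s + 1, ..., t\<close>. This matches
  \<open>queue n \<pi> a (Suc s)\<close>, the state after \<open>s\<close> slots.\<close>

definition arrivals :: "(nat \<Rightarrow> port_matrix) \<Rightarrow> nat \<Rightarrow> nat \<Rightarrow> port_matrix" where
  "arrivals x s t = (\<lambda>i j. \<Sum>r=s..<t. x (Suc r) i j)"

lemma arrivals_Suc: "s \<le> t \<Longrightarrow> arrivals x s (Suc t) i j = arrivals x s t i j + x (Suc t) i j"
  by (simp add: arrivals_def)

lemma arrivals_mono: "t \<le> t' \<Longrightarrow> arrivals x s t i j \<le> arrivals x s t' i j"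
  unfolding arrivals_def by (intro sum_mono2) auto

text \<open>The cyclic Latin square: for fixed \<open>v\<close> the served queues form a broken
  antidiagonal, and \<open>n\<close> consecutive values of \<open>v\<close> meet each queue exactly
  once.\<close>

definition round_robin :: "nat \<Rightarrow> nat \<Rightarrow> port_matrix" where
  "round_robin n v = (\<lambda>i j. of_bool (i \<in> {1..n} \<and> j \<in> {1..n} \<and> n dvd i + j + v))"

lemma card_residue_class:
  fixes c n :: nat
  assumes "n > 0"
  shows "(\<Sum>j=1..n. of_bool (n dvd c + j)) = (1::nat)"
proof -
  define r where "r = n - c mod n"
  have lt: "c mod n < n" using assms by simp
  have "n dvd c + j \<longleftrightarrow> j = r" if "j \<in> {1..n}" for j
  proof -
    have "n dvd c + j \<longleftrightarrow> (c mod n + j) mod n = 0" by (simp add: dvd_eq_mod_eq_0 mod_add_left_eq)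
    also have "\<dots> \<longleftrightarrow> c mod n + j = n"
    proof
      assume "(c mod n + j) mod n = 0"
      then obtain e where e: "c mod n + j = n * e" by auto
      have "0 < j" "j \<le> n" using that by auto
      with lt e have "n * e < n * 2" "0 < n * e" by linarith+
      then have "e = 1" by auto
      with e show "c mod n + j = n" by simp
    qed simp
    also have "\<dots> \<longleftrightarrow> j = r" using lt by (auto simp: r_def)
    finally show ?thesis .
  qed
  then have "(\<Sum>j=1..n. of_bool (n dvd c + j)) = (\<Sum>j=1..n. if j = r then 1 else (0::nat))"
    by (intro sum.cong) auto
  also have "\<dots> = 1" using lt by (simp add: r_def)
  finally show ?thesis .
qed

lemma round_robin_row: "i \<in> {1..n} \<Longrightarrow> (\<Sum>j=1..n. round_robin n v i j) = 1"
  using card_residue_class[of n "i + v"] by (simp add: round_robin_def ac_simps)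

lemma round_robin_column: "j \<in> {1..n} \<Longrightarrow> (\<Sum>i=1..n. round_robin n v i j) = 1"
  using card_residue_class[of n "j + v"] by (simp add: round_robin_def ac_simps)

lemma round_robin_schedule: "round_robin n v \<in> schedules n"
  unfolding schedules_def
  by (auto simp: round_robin_row[simplified] round_robin_column[simplified])
    (auto simp: round_robin_def)

definition round_robin_count :: "nat \<Rightarrow> nat \<Rightarrow> port_matrix" where
  "round_robin_count n m = (\<lambda>i j. \<Sum>v<m. round_robin n v i j)"

text \<open>Services of queue \<open>(i, j)\<close> correspond to the multiples of \<open>n\<close>
  among \<open>i + j, ..., i + j + m - 1\<close>, and \<open>(y + n - 1) div n\<close> is the
  ceiling of \<open>y / n\<close>, the number of multiples of \<open>n\<close> below
  \<open>y\<close>.\<close>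

lemma round_robin_count_eq:
  assumes "n > 0" and "i \<in> {1..n}" and "j \<in> {1..n}"
  shows "round_robin_count n m i j + (i + j + n - 1) div n = (i + j + m + n - 1) div n"
proof (induction m)
  case (Suc m)
  have "(i + j + Suc m + n - 1) div n = Suc (i + j + m + n - 1) div n"
    using assms by (simp add: Suc_diff_le)
  also have "\<dots> = (i + j + m + n - 1) div n + of_bool (n dvd i + j + m)"
  proof -
    have eq: "Suc (i + j + m + n - 1) = i + j + m + n" using assms by simp
    have "Suc (i + j + m + n - 1) mod n = 0 \<longleftrightarrow> n dvd i + j + m"
      unfolding eq by (simp add: dvd_eq_mod_eq_0)
    then show ?thesis by (simp add: div_Suc)
  qed
  finally show ?case
    using Suc.IH assms by (simp add: round_robin_count_def round_robin_def)
qed (simp add: round_robin_count_def)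

lemma round_robin_count_le:
  assumes "n > 0" and "i \<in> {1..n}" and "j \<in> {1..n}"
  shows "round_robin_count n m i j \<le> m div n + 1"
proof -
  let ?c = "i + j + n - 1"
  have "(i + j + m + n - 1) div n = (?c + m) div n"
    using assms by (simp add: ac_simps)
  also have "\<dots> = ?c div n + m div n + (?c mod n + m mod n) div n" by (rule div_add1_eq)
  also have "(?c mod n + m mod n) div n \<le> 1"
  proof -
    have "?c mod n < n" "m mod n < n" using assms(1) by simp_all
    then have "?c mod n + m mod n < 2 * n" by linarith
    then show ?thesis using less_mult_imp_div_less by fastforce
  qed
  finally show ?thesis using round_robin_count_eq[OF assms, of m] by simp
qed

lemma round_robin_count_cycles:
  assumes "n > 0" and "i \<in> {1..n}" and "j \<in> {1..n}"
  shows "round_robin_count n (n * w) i j = w"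
proof -
  have "i + j + n * w + n - 1 = (i + j + n - 1) + n * w" using assms by simp
  then have "(i + j + n * w + n - 1) div n = w + (i + j + n - 1) div n"
    using assms(1) by (simp only: div_mult_self2 neq0_conv)
  then show ?thesis using round_robin_count_eq[OF assms, of "n * w"] by linarith
qed

lemma sum_round_robin_count: "(\<Sum>i=1..n. \<Sum>j=1..n. round_robin_count n m i j) = n * m"
proof -
  have "(\<Sum>i=1..n. \<Sum>j=1..n. round_robin_count n m i j) =
      (\<Sum>i=1..n. \<Sum>v<m. \<Sum>j=1..n. round_robin n v i j)"
    unfolding round_robin_count_def by (intro sum.cong refl sum.swap)
  also have "\<dots> = (\<Sum>i=1..n. \<Sum>v<m. 1)"
    by (intro sum.cong refl round_robin_row)
  finally show ?thesis by simp
qed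

text \<open>For \<open>n \<le> d\<close> the line bound \<open>d - n\<close> holds by construction:
  a matrix violating it is replaced by zero, so a clearing exists after every batch, and what is
  dropped is charged to the backlog. The reserve \<open>n\<close> leaves room for one extra packet
  in each of the \<open>n\<close> queues of a line.\<close>

definition leftover :: "nat \<Rightarrow> nat \<Rightarrow> nat \<Rightarrow> port_matrix \<Rightarrow> port_matrix" where
  "leftover n d w m =
    (if (\<forall>i\<in>{1..n}. (\<Sum>j=1..n. m i j - w) + n \<le> d) \<and>
        (\<forall>j\<in>{1..n}. (\<Sum>i=1..n. m i j - w) + n \<le> d)
     then (\<lambda>i j. m i j - w) else (\<lambda>i j. 0))"

lemma leftover_row: "n \<le> d \<Longrightarrow> i \<in> {1..n} \<Longrightarrow> (\<Sum>j=1..n. leftover n d w m i j) + n \<le> d"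
  by (simp add: leftover_def)

lemma leftover_column: "n \<le> d \<Longrightarrow> j \<in> {1..n} \<Longrightarrow> (\<Sum>i=1..n. leftover n d w m i j) + n \<le> d"
  by (simp add: leftover_def)

text \<open>The successor stands for the extra service that each queue gets in every clearing, which
  makes the backlog decrease. The choice is meaningful for line sums up to \<open>d - n\<close>, by
  \<open>koenig_schedules\<close>.\<close>

definition clearing :: "nat \<Rightarrow> nat \<Rightarrow> port_matrix \<Rightarrow> nat \<Rightarrow> port_matrix" where
  "clearing n d m = (SOME \<sigma>. (\<forall>u. \<sigma> u \<in> schedules n) \<and>
     (\<forall>i\<in>{1..n}. \<forall>j\<in>{1..n}. Suc (m i j) \<le> (\<Sum>u<d. \<sigma> u i j)))"

lemma clearing_leftover:
  assumes "n \<le> d"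
  shows "clearing n d (leftover n d w m) u \<in> schedules n"
    and "i \<in> {1..n} \<Longrightarrow> j \<in> {1..n} \<Longrightarrow>
      Suc (leftover n d w m i j) \<le> (\<Sum>u<d. clearing n d (leftover n d w m) u i j)"
proof -
  have "\<exists>\<sigma>. (\<forall>u. \<sigma> u \<in> schedules n) \<and>
      (\<forall>i\<in>{1..n}. \<forall>j\<in>{1..n}. Suc (leftover n d w m i j) \<le> (\<Sum>u<d. \<sigma> u i j))"
  proof (rule koenig_schedules)
    show "(\<Sum>j=1..n. Suc (leftover n d w m i j)) \<le> d" if "i \<in> {1..n}" for i
      using leftover_row[OF assms that] by (subst sum_Suc) simp
    show "(\<Sum>i=1..n. Suc (leftover n d w m i j)) \<le> d" if "j \<in> {1..n}" for j
      using leftover_column[OF assms that] by (subst sum_Suc) simp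
  qed
  note spec = someI_ex[OF this, folded clearing_def]
  show "clearing n d (leftover n d w m) u \<in> schedules n"
    and "i \<in> {1..n} \<Longrightarrow> j \<in> {1..n} \<Longrightarrow>
      Suc (leftover n d w m i j) \<le> (\<Sum>u<d. clearing n d (leftover n d w m) u i j)"
    using spec by blast+
qed

text \<open>Truncated subtraction absorbs the emptiness test, since serving an empty queue leaves it
  at 0.\<close>

lemma queue_Suc_nat:
  "queue n \<pi> a (Suc (Suc s)) i j =
    queue n \<pi> a (Suc s) i j - schedule n \<pi> a (Suc s) i j + new_arrivals n a (Suc s) i j"
  by (simp add: queue_def schedule_def Let_def case_prod_beta)

section \<open>The policy, good batches and the backlog\<close>

locale batching =
  fixes n d w :: nat
  assumes n_pos: "0 < n" and n_le_d: "n \<le> d"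
begin

definition batch_length :: nat where
  "batch_length = d + n * w"

abbreviation b :: nat where
  "b \<equiv> batch_length"

lemma b_pos: "0 < b" and d_le_b: "d \<le> b"
  using n_pos n_le_d by (simp_all add: batch_length_def)

text \<open>The matrix cleared in period \<open>k\<close> is computed from the arrivals of the batch
  that has just ended rather than from the queue sizes. Before the first batch there is nothing to
  clear.\<close>

definition pending :: "(nat \<Rightarrow> port_matrix) \<Rightarrow> nat \<Rightarrow> port_matrix" where
  "pending x k = leftover n d w
     (case k of 0 \<Rightarrow> (\<lambda>i j. 0) | Suc l \<Rightarrow> arrivals x (l * b) (k * b))"

text \<open>Slot \<open>t\<close> sits at index \<open>t - 1\<close> of the history. Since
  \<open>d\<close> is both the head start and the clearing time, the service windows of length
  \<open>b\<close> tile the time axis, and each period opens with the clearing of the preceding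
  batch.\<close>

definition batch_policy :: policy where
  "batch_policy h q =
    (let k = length h div b; u = length h mod b
     in if u < d then clearing n d (pending (\<lambda>t. snd (snd (h ! (t - 1)))) k) u
        else round_robin n (u - d))"

text \<open>By the strict inequality, when round-robin slot \<open>v\<close> begins the queue has
  received more packets of this batch than it has been offered services. The reserve
  \<open>n\<close> on the lines becomes the reserve in \<open>leftover\<close>, because round robin
  takes \<open>n * w = b - d\<close> from each line.\<close>

definition good_batch :: "(nat \<Rightarrow> port_matrix) \<Rightarrow> nat \<Rightarrow> bool" where
  "good_batch x k \<longleftrightarrow>
    (\<forall>i\<in>{1..n}. \<forall>j\<in>{1..n}. \<forall>v<n * w.
       round_robin_count n v i j < arrivals x (k * b) (k * b + d + v) i j) \<and>
    (\<forall>i\<in>{1..n}. (\<Sum>j=1..n. arrivals x (k * b) (Suc k * b) i j) + n \<le> b) \<and>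
    (\<forall>j\<in>{1..n}. (\<Sum>i=1..n. arrivals x (k * b) (Suc k * b) i j) + n \<le> b)"

text \<open>A random walk reflected at 0, common to all queues: it bounds the excess of each queue
  over \<open>pending\<close> at the start of a period.\<close>

primrec backlog :: "(nat \<Rightarrow> port_matrix) \<Rightarrow> nat \<Rightarrow> nat" where
  "backlog x 0 = 0"
| "backlog x (Suc k) = (backlog x k - 1) + (if good_batch x k then 0 else b)"

lemma scheduling_batch_policy: "scheduling_policy n batch_policy"
  unfolding scheduling_policy_def batch_policy_def Let_def pending_def
  by (simp add: clearing_leftover(1)[OF n_le_d] round_robin_schedule)

text \<open>The history has length \<open>k * b + u\<close> at this time, so it contains all slots
  of the batches before \<open>k\<close>, and the arrivals read from it are the true ones.\<close>

lemma schedule_batch_policy: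
  assumes "u < b"
  shows "schedule n batch_policy a (Suc (k * b + u)) =
    (if u < d then clearing n d (pending (new_arrivals n a) k) u else round_robin n (u - d))"
proof -
  define s where "s = k * b + u"
  define h where "h = map (\<lambda>s. (queue n batch_policy a s, schedule n batch_policy a s,
    new_arrivals n a s)) [1..<Suc s]"
  have len: "length h = s" by (simp add: h_def)
  have div: "s div b = k" "s mod b = u" using assms by (simp_all add: s_def)
  have nth: "snd (snd (h ! (Suc r - 1))) = new_arrivals n a (Suc r)" if "r < s" for r
    using that by (simp add: h_def nth_map_upt del: upt_Suc)
  have "pending (\<lambda>t. snd (snd (h ! (t - 1)))) k = pending (new_arrivals n a) k"
  proof (cases k)
    case (Suc l)
    have "arrivals (\<lambda>t. snd (snd (h ! (t - 1)))) (l * b) (k * b) =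
        arrivals (new_arrivals n a) (l * b) (k * b)"
      unfolding arrivals_def by (intro ext sum.cong refl) (simp add: nth[simplified] s_def)
    then show ?thesis by (simp add: pending_def Suc)
  qed (simp add: pending_def)
  moreover have "schedule n batch_policy a (Suc s) = batch_policy h (queue n batch_policy a (Suc s))"
    unfolding h_def by (rule schedule_eq) simp
  ultimately show ?thesis by (simp add: batch_policy_def Let_def len div s_def[symmetric])
qed

section \<open>Evolution of one queue during one period\<close>

context
  fixes a :: "nat \<Rightarrow> nat \<Rightarrow> nat \<Rightarrow> nat" and x :: "nat \<Rightarrow> port_matrix" and i j :: nat
  assumes x: "x = new_arrivals n a" and ij: "i \<in> {1..n}" "j \<in> {1..n}"
    and x_le_1: "\<And>t. x (Suc t) i j \<le> 1"
begin

abbreviation Q :: "nat \<Rightarrow> nat" where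
  "Q s \<equiv> queue n batch_policy a (Suc s) i j"

text \<open>The truncation acts on the initial content only: \<open>(X + y) - z\<close> is at most
  \<open>(X - z) + y\<close>, so arrivals during the clearing are counted as if none of them were
  served.\<close>

lemma clearing_bound:
  assumes "u \<le> d"
  shows "Q (k * b + u) \<le>
    (Q (k * b) - (\<Sum>v<u. clearing n d (pending x k) v i j)) + arrivals x (k * b) (k * b + u) i j"
  using assms
proof (induction u)
  case (Suc u)
  then have "u < b" using d_le_b by simp
  then show ?case
    using Suc schedule_batch_policy[of u a k]
    by (simp add: queue_Suc_nat arrivals_Suc x)
qed (simp add: arrivals_def)

lemma after_clearing:
  assumes "Q (k * b) \<le> backlog x k + pending x k i j"
  shows "Q (k * b + d) \<le> (backlog x k - 1) + arrivals x (k * b) (k * b + d) i j"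
proof -
  have "Suc (pending x k i j) \<le> (\<Sum>v<d. clearing n d (pending x k) v i j)"
    unfolding pending_def by (rule clearing_leftover(2)[OF n_le_d ij])
  with clearing_bound[of d k] assms show ?thesis by linarith
qed

text \<open>The first bound gives no credit for round-robin service and survives a bad batch; the
  second credits every service offered.\<close>

lemma round_robin_bound:
  assumes "Q (k * b) \<le> backlog x k + pending x k i j" and "v \<le> n * w"
  shows "Q (k * b + d + v) \<le> (backlog x k - 1) + arrivals x (k * b) (k * b + d + v) i j"
    and "good_batch x k \<Longrightarrow> Q (k * b + d + v) + round_robin_count n v i j \<le>
      (backlog x k - 1) + arrivals x (k * b) (k * b + d + v) i j"
proof -
  have step: "Q (k * b + d + Suc v) =
      Q (k * b + d + v) - round_robin n v i j + x (Suc (k * b + d + v)) i j"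
    if "v < n * w" for v
    using schedule_batch_policy[of "d + v" a k] that
    by (simp add: queue_Suc_nat x batch_length_def add.assoc)
  have arr: "arrivals x (k * b) (k * b + d + Suc v) i j =
      arrivals x (k * b) (k * b + d + v) i j + x (Suc (k * b + d + v)) i j" for v
    using arrivals_Suc[of "k * b" "k * b + d + v" x i j] by simp
  show "Q (k * b + d + v) \<le> (backlog x k - 1) + arrivals x (k * b) (k * b + d + v) i j"
    using assms(2)
  proof (induction v)
    case 0
    show ?case using after_clearing[OF assms(1)] by simp
  next
    case (Suc v)
    then show ?case using step[of v] arr[of v] by linarith
  qed
  show "Q (k * b + d + v) + round_robin_count n v i j \<le>
      (backlog x k - 1) + arrivals x (k * b) (k * b + d + v) i j" if good: "good_batch x k"
    using assms(2)
  proof (induction v)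
    case 0
    show ?case using after_clearing[OF assms(1)] by (simp add: round_robin_count_def)
  next
    case (Suc v)
    \<comment> \<open>A nonempty queue loses the credited packet. A scheduled queue that is empty
      satisfies the bound anyway: by strictness the arrivals already cover the count including the
      present slot.\<close>
    have "round_robin_count n v i j < arrivals x (k * b) (k * b + d + v) i j"
      using good ij Suc.prems unfolding good_batch_def by (meson Suc_le_lessD)
    moreover have "round_robin n v i j \<le> 1" by (simp add: round_robin_def)
    moreover have "round_robin_count n (Suc v) i j = round_robin_count n v i j + round_robin n v i j"
      by (simp add: round_robin_count_def)
    ultimately show ?case using Suc step[of v] arr[of v] by linarith
  qed
qed

text \<open>Every queue receives at least \<open>w\<close> packets in a good batch, so the truncated
  differences are exact and each line sums to at most \<open>b - n - n * w = d - n\<close>.\<close>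

lemma leftover_good_batch:
  assumes "good_batch x k"
  shows "pending x (Suc k) = (\<lambda>i j. arrivals x (k * b) (Suc k * b) i j - w)"
proof -
  let ?A = "arrivals x (k * b) (Suc k * b)"
  have w_le: "w \<le> ?A p q" if pq: "p \<in> {1..n}" "q \<in> {1..n}" for p q
  proof (cases "w = 0")
    case False
    \<comment> \<open>The last round-robin slot. It contributes at most one of the \<open>w\<close>
      services, and the strict inequality for the count before it makes up for that one.\<close>
    define v where "v = n * w - 1"
    have v: "Suc v = n * w" using False n_pos by (simp add: v_def)
    have "w = round_robin_count n (Suc v) p q"
      unfolding v using round_robin_count_cycles[OF n_pos pq] by simp
    also have "\<dots> \<le> Suc (round_robin_count n v p q)"
      by (simp add: round_robin_count_def round_robin_def)
    also have "\<dots> \<le> arrivals x (k * b) (k * b + d + v) p q"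
      using assms pq v unfolding good_batch_def by (simp add: Suc_le_eq)
    also have "\<dots> \<le> ?A p q" by (rule arrivals_mono) (use v in \<open>simp add: batch_length_def\<close>)
    finally show ?thesis .
  qed simp
  have "(\<Sum>q=1..n. ?A p q - w) + n \<le> d" if "p \<in> {1..n}" for p
  proof -
    have "(\<Sum>q=1..n. ?A p q - w) = (\<Sum>q=1..n. ?A p q) - n * w"
      using w_le that by (subst sum_subtractf_nat) auto
    moreover have "(\<Sum>q=1..n. ?A p q) + n \<le> b" using assms that by (simp add: good_batch_def)
    ultimately show ?thesis using n_le_d by (simp add: batch_length_def)
  qed
  moreover have "(\<Sum>p=1..n. ?A p q - w) + n \<le> d" if "q \<in> {1..n}" for q
  proof -
    have "(\<Sum>p=1..n. ?A p q - w) = (\<Sum>p=1..n. ?A p q) - n * w"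
      using w_le that by (subst sum_subtractf_nat) auto
    moreover have "(\<Sum>p=1..n. ?A p q) + n \<le> b" using assms that by (simp add: good_batch_def)
    ultimately show ?thesis using n_le_d by (simp add: batch_length_def)
  qed
  ultimately show ?thesis unfolding pending_def leftover_def by simp
qed

text \<open>The invariant at batch boundaries. After a good batch the \<open>w\<close> credited
  services turn the arrivals into exactly the next \<open>pending\<close>; after a bad one the whole
  batch, at most one packet per slot, is charged to the backlog.\<close>

lemma batch_start_bound: "Q (k * b) \<le> backlog x k + pending x k i j"
proof (induction k)
  case 0
  then show ?case using queue_1[of n batch_policy a i j] by simp
next
  case (Suc k)
  have eq: "k * b + d + n * w = Suc k * b" by (simp add: batch_length_def)
  show ?case
  proof (cases "good_batch x k")
    case True
    have "Q (Suc k * b) + w \<le> (backlog x k - 1) + arrivals x (k * b) (Suc k * b) i j"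
      using round_robin_bound(2)[OF Suc.IH order_refl True] round_robin_count_cycles[OF n_pos ij]
      unfolding eq by simp
    then show ?thesis using True by (simp add: leftover_good_batch del: mult_Suc)
  next
    case False
    have "arrivals x (k * b) (Suc k * b) i j \<le> (\<Sum>r=k * b..<Suc k * b. 1)"
      unfolding arrivals_def by (intro sum_mono x_le_1)
    then have "arrivals x (k * b) (Suc k * b) i j \<le> b" by simp
    then show ?thesis
      using round_robin_bound(1)[OF Suc.IH order_refl] False unfolding eq by simp
  qed
qed

end

text \<open>One formula serves both phases, so that expectations can be taken at a fixed time. The
  term \<open>n * d\<close> covers the leftovers during the clearing; the bracket compares the
  arrivals with the \<open>n\<close> services per slot of round robin. On a bad batch these services
  are not credited, and the last term pays the deduction back.\<close>

lemma total_queue_bound: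
  assumes x: "x = new_arrivals n a"
    and x_le_1: "\<And>t i j. i \<in> {1..n} \<Longrightarrow> j \<in> {1..n} \<Longrightarrow> x (Suc t) i j \<le> 1"
    and u: "u < b"
  shows "real (\<Sum>i=1..n. \<Sum>j=1..n. queue n batch_policy a (Suc (k * b + u)) i j) \<le>
    real n ^ 2 * real (backlog x k) + real n * real d
      + (real (\<Sum>i=1..n. \<Sum>j=1..n. arrivals x (k * b) (k * b + u) i j) - real n * (real u - real d))
      + real n * real b * of_bool (\<not> good_batch x k)"
proof -
  let ?Q = "\<Sum>i=1..n. \<Sum>j=1..n. queue n batch_policy a (Suc (k * b + u)) i j"
  let ?A = "\<Sum>i=1..n. \<Sum>j=1..n. arrivals x (k * b) (k * b + u) i j"
  let ?N = "backlog x k"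
  have const: "(\<Sum>i=1..n. \<Sum>j=1..n. c) = n ^ 2 * c" for c :: nat
    by (simp add: power2_eq_square)
  show ?thesis
  proof (cases "u \<le> d")
    case True
    have "queue n batch_policy a (Suc (k * b + u)) i j \<le>
        ?N + (pending x k i j + arrivals x (k * b) (k * b + u) i j)"
      if "i \<in> {1..n}" "j \<in> {1..n}" for i j
      using clearing_bound[OF x that x_le_1[OF that] True, of k]
        batch_start_bound[OF x that x_le_1[OF that], of k] by linarith
    then have "?Q \<le> (\<Sum>i=1..n. \<Sum>j=1..n. ?N + (pending x k i j + arrivals x (k * b) (k * b + u) i j))"
      by (intro sum_mono) auto
    also have "\<dots> = n ^ 2 * ?N + ((\<Sum>i=1..n. \<Sum>j=1..n. pending x k i j) + ?A)"
      by (simp only: sum.distrib const)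
    finally have "?Q \<le> n ^ 2 * ?N + ((\<Sum>i=1..n. \<Sum>j=1..n. pending x k i j) + ?A)" .
    moreover have "(\<Sum>i=1..n. \<Sum>j=1..n. pending x k i j) \<le> (\<Sum>i=1..n. d)"
      unfolding pending_def by (intro sum_mono add_leD1[OF leftover_row[OF n_le_d]])
    ultimately have "?Q \<le> n ^ 2 * ?N + (n * d + ?A)" by simp
    then have "real ?Q \<le> real (n ^ 2 * ?N + (n * d + ?A))" by (rule of_nat_mono)
    moreover have "real n * (real u - real d) \<le> 0"
      using True by (simp add: mult_nonneg_nonpos)
    moreover have "0 \<le> real n * real b * of_bool (\<not> good_batch x k)" by simp
    ultimately show ?thesis unfolding of_nat_add of_nat_mult of_nat_power by linarith
  next
    case False
    define v where "v = u - d"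
    have v: "k * b + u = k * b + d + v" "v \<le> n * w"
      using False u by (simp_all add: v_def batch_length_def)
    note bounds = round_robin_bound[OF x _ _ _ batch_start_bound[OF x] v(2), of _ _ k, folded v(1)]
    show ?thesis
    proof (cases "good_batch x k")
      case True
      have "queue n batch_policy a (Suc (k * b + u)) i j + round_robin_count n v i j \<le>
          ?N + arrivals x (k * b) (k * b + u) i j"
        if "i \<in> {1..n}" "j \<in> {1..n}" for i j
        using bounds(2)[OF that x_le_1[OF that] that x_le_1[OF that] True] by linarith
      then have "(\<Sum>i=1..n. \<Sum>j=1..n. queue n batch_policy a (Suc (k * b + u)) i j
            + round_robin_count n v i j) \<le>
          (\<Sum>i=1..n. \<Sum>j=1..n. ?N + arrivals x (k * b) (k * b + u) i j)"
        by (intro sum_mono) auto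
      then have "?Q + n * v \<le> n ^ 2 * ?N + ?A"
        by (simp only: sum.distrib const sum_round_robin_count)
      then have "real (?Q + n * v) \<le> real (n ^ 2 * ?N + ?A)" by (rule of_nat_mono)
      moreover have "0 \<le> real n * real d" by simp
      moreover have "real n * (real u - real d) = real n * real v" using False by (simp add: v_def)
      moreover have "real n * real b * of_bool (\<not> good_batch x k) = 0" using True by simp
      ultimately show ?thesis
        unfolding of_nat_add of_nat_mult of_nat_power by linarith
    next
      case bad: False
      have "queue n batch_policy a (Suc (k * b + u)) i j \<le>
          ?N + arrivals x (k * b) (k * b + u) i j"
        if "i \<in> {1..n}" "j \<in> {1..n}" for i j
        using bounds(1)[OF that x_le_1[OF that] that x_le_1[OF that]] by linarith
      then have "?Q \<le> (\<Sum>i=1..n. \<Sum>j=1..n. ?N + arrivals x (k * b) (k * b + u) i j)"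
        by (intro sum_mono) auto
      then have "?Q \<le> n ^ 2 * ?N + ?A" by (simp only: sum.distrib const)
      then have "real ?Q \<le> real (n ^ 2 * ?N + ?A)" by (rule of_nat_mono)
      moreover have "real n * (real u - real d) \<le> real n * real b"
        using u by (intro mult_left_mono) auto
      moreover have "0 \<le> real n * real d" by simp
      moreover have "real n * real b * of_bool (\<not> good_batch x k) = real n * real b"
        using bad by simp
      ultimately show ?thesis unfolding of_nat_add of_nat_mult of_nat_power by linarith
    qed
  qed
qed

end

section \<open>Joint independence and exponential moments of the arrivals\<close>

text \<open>The model gives independence of whole processes and, within each process, independence
  of increments; here they merge into one family. A finite subfamily is grouped by first index. The
  events of a group together form an event of \<open>X i\<close>, so the outer product formula
  applies to groups and the inner one within each group.\<close>

lemma (in prob_space) indep_vars_Sigma: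
  assumes outer: "indep_vars M' X I"
    and inner: "\<And>i. i \<in> I \<Longrightarrow> indep_vars (N i) (Y i) (T i)"
    and f: "\<And>i t. i \<in> I \<Longrightarrow> t \<in> T i \<Longrightarrow> f i t \<in> measurable (M' i) (N i t)"
    and Y: "\<And>i t \<omega>. i \<in> I \<Longrightarrow> t \<in> T i \<Longrightarrow> \<omega> \<in> space M \<Longrightarrow> Y i t \<omega> = f i t (X i \<omega>)"
  shows "indep_vars (\<lambda>p. N (fst p) (snd p)) (\<lambda>p. Y (fst p) (snd p)) (Sigma I T)"
  unfolding indep_vars_def2
proof (intro conjI ballI)
  fix p assume "p \<in> Sigma I T"
  then show "random_variable (N (fst p) (snd p)) (Y (fst p) (snd p))"
    using inner unfolding indep_vars_def2 by auto
next
  let ?F = "\<lambda>p. {Y (fst p) (snd p) -` B \<inter> space M |B. B \<in> sets (N (fst p) (snd p))}"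
  show "indep_sets ?F (Sigma I T)"
  proof (rule indep_setsI)
    fix p assume "p \<in> Sigma I T"
    then have "random_variable (N (fst p) (snd p)) (Y (fst p) (snd p))"
      using inner unfolding indep_vars_def2 by auto
    then show "?F p \<subseteq> events" by (auto intro: measurable_sets)
  next
    fix E J
    assume J: "J \<noteq> {}" "J \<subseteq> Sigma I T" "finite J" "\<forall>p\<in>J. E p \<in> ?F p"
    define I' where "I' = fst ` J"
    define T' where "T' i = {t. (i, t) \<in> J}" for i
    have J_eq: "J = Sigma I' T'" by (force simp: I'_def T'_def)
    have I': "finite I'" "I' \<noteq> {}" "I' \<subseteq> I" using J by (auto simp: I'_def)
    have "T' i = snd ` (J \<inter> {i} \<times> UNIV)" for i by (force simp: T'_def)
    then have finT: "finite (T' i)" for i using J(3) by simp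
    have T': "T' i \<noteq> {}" "T' i \<subseteq> T i" if "i \<in> I'" for i
      using that J(2) by (auto simp: I'_def T'_def)
    have "\<forall>p\<in>J. \<exists>B. B \<in> sets (N (fst p) (snd p)) \<and> E p = Y (fst p) (snd p) -` B \<inter> space M"
      using J(4) by blast
    from bchoice[OF this] obtain B where
      B: "\<forall>p\<in>J. B p \<in> sets (N (fst p) (snd p)) \<and> E p = Y (fst p) (snd p) -` B p \<inter> space M"
      by blast
    have E: "E (i, t) = Y i t -` B (i, t) \<inter> space M" "B (i, t) \<in> sets (N i t)"
      if "i \<in> I'" "t \<in> T' i" for i t
    proof -
      have "(i, t) \<in> J" using that(2) by (simp add: T'_def)
      from bspec[OF B this]
      show "E (i, t) = Y i t -` B (i, t) \<inter> space M" "B (i, t) \<in> sets (N i t)" by simp_all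
    qed
    have inner_prod: "prob (\<Inter>t\<in>T' i. E (i, t)) = (\<Prod>t\<in>T' i. prob (E (i, t)))" if i: "i \<in> I'" for i
    proof (rule indep_setsD)
      show "indep_sets (\<lambda>t. {Y i t -` B \<inter> space M |B. B \<in> sets (N i t)}) (T i)"
        using inner[of i] I' i unfolding indep_vars_def2 by blast
      show "\<forall>t\<in>T' i. E (i, t) \<in> {Y i t -` B \<inter> space M |B. B \<in> sets (N i t)}"
      proof
        fix t assume "t \<in> T' i"
        with E[OF i] show "E (i, t) \<in> {Y i t -` B \<inter> space M |B. B \<in> sets (N i t)}"
          by (intro CollectI exI[of _ "B (i, t)"]) simp
      qed
    qed (use T' finT i in auto)
    have outer_prod: "prob (\<Inter>i\<in>I'. \<Inter>t\<in>T' i. E (i, t)) = (\<Prod>i\<in>I'. prob (\<Inter>t\<in>T' i. E (i, t)))"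
    proof (rule indep_setsD)
      show "indep_sets (\<lambda>i. {X i -` B \<inter> space M |B. B \<in> sets (M' i)}) I"
        using outer unfolding indep_vars_def2 by blast
      show "\<forall>i\<in>I'. (\<Inter>t\<in>T' i. E (i, t)) \<in> {X i -` B \<inter> space M |B. B \<in> sets (M' i)}"
      proof
        fix i assume i: "i \<in> I'"
        then have iI: "i \<in> I" using I' by blast
        have X: "X i \<omega> \<in> space (M' i)" if "\<omega> \<in> space M" for \<omega>
          using outer iI that unfolding indep_vars_def2 by (auto dest: measurable_space)
        \<comment> \<open>The set of values of \<open>X i\<close> that encodes all events of the
          group at once; it is a finite nonempty intersection of measurable sets.\<close>
        define C where "C = (\<Inter>t\<in>T' i. f i t -` B (i, t) \<inter> space (M' i))"
        have "C \<in> sets (M' i)"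
          unfolding C_def
        proof (rule sets.finite_INT)
          show "f i t -` B (i, t) \<inter> space (M' i) \<in> sets (M' i)" if "t \<in> T' i" for t
            using T'(2)[OF i] that by (intro measurable_sets[OF f[OF iI] E(2)[OF i]]) auto
        qed (use finT T'(1)[OF i] in auto)
        moreover have "(\<Inter>t\<in>T' i. E (i, t)) = X i -` C \<inter> space M"
        proof -
          have "E (i, t) = X i -` (f i t -` B (i, t) \<inter> space (M' i)) \<inter> space M"
            if t: "t \<in> T' i" for t
          proof -
            have "t \<in> T i" using T'(2)[OF i] t by blast
            from Y[OF iI this] X show ?thesis unfolding E(1)[OF i t] by auto
          qed
          then show ?thesis unfolding C_def using T'(1)[OF i] by auto
        qed
        ultimately show "(\<Inter>t\<in>T' i. E (i, t)) \<in> {X i -` B \<inter> space M |B. B \<in> sets (M' i)}" by blast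
      qed
    qed (use I' in auto)
    have "(\<Inter>p\<in>J. E p) = (\<Inter>i\<in>I'. \<Inter>t\<in>T' i. E (i, t))" by (auto simp: J_eq)
    then have "prob (\<Inter>p\<in>J. E p) = (\<Prod>i\<in>I'. \<Prod>t\<in>T' i. prob (E (i, t)))"
      by (simp add: outer_prod inner_prod)
    also have "\<dots> = (\<Prod>p\<in>J. prob (E p))"
      unfolding J_eq using I' finT by (subst prod.Sigma) (auto intro: prod.cong)
    finally show "prob (\<Inter>p\<in>J. E p) = (\<Prod>p\<in>J. prob (E p))" .
  qed
qed

section \<open>Law and independence of the slot arrivals\<close>

locale bernoulli_switch =
  fixes M :: "'w measure" and n :: nat and \<rho> :: real
    and A :: "nat \<Rightarrow> nat \<Rightarrow> nat \<Rightarrow> 'w \<Rightarrow> nat"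
  assumes bernoulli: "bernoulli_arrivals M n \<rho> A" and ports: "0 < n"
    and rate: "0 \<le> \<rho>" "\<rho> \<le> 1"
begin

sublocale prob_space M
  using bernoulli by (simp add: bernoulli_arrivals_def)

definition increments :: "'w \<Rightarrow> nat \<Rightarrow> port_matrix" where
  "increments \<omega> = new_arrivals n (\<lambda>i j t. A i j t \<omega>)"

text \<open>Queue and slot are combined into one index, so that all arrivals form a single
  independent family with a common law.\<close>

definition slot_arrivals :: "(nat \<times> nat) \<times> nat \<Rightarrow> 'w \<Rightarrow> nat" where
  "slot_arrivals p \<omega> = increments \<omega> (snd p) (fst (fst p)) (snd (fst p))"

definition slots :: "nat set \<Rightarrow> ((nat \<times> nat) \<times> nat) set" where
  "slots T = ({1..n} \<times> {1..n}) \<times> T"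

lemma slot_arrivals_eq:
  "p \<in> slots T \<Longrightarrow> slot_arrivals p \<omega> =
    A (fst (fst p)) (snd (fst p)) (snd p) \<omega> - A (fst (fst p)) (snd (fst p)) (snd p - 1) \<omega>"
  by (auto simp: slot_arrivals_def slots_def increments_def new_arrivals_def)

lemma indep_slot_arrivals: "indep_vars (\<lambda>_. count_space UNIV) slot_arrivals (slots {1..})"
proof -
  have "indep_vars (\<lambda>p. count_space UNIV)
      (\<lambda>p \<omega>. A (fst (fst p)) (snd (fst p)) (snd p) \<omega> - A (fst (fst p)) (snd (fst p)) (snd p - 1) \<omega>)
      (slots {1..})"
    unfolding slots_def
  proof (rule indep_vars_Sigma[where
        M' = "\<lambda>_. \<Pi>\<^sub>M \<tau>\<in>UNIV. count_space UNIV" and X = "\<lambda>(i, j) \<omega> \<tau>. A i j \<tau> \<omega>" and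
        N = "\<lambda>_ _. count_space UNIV" and
        Y = "\<lambda>i t \<omega>. A (fst i) (snd i) t \<omega> - A (fst i) (snd i) (t - 1) \<omega>" and
        f = "\<lambda>_ t y. y t - y (t - 1)"])
    show "(\<lambda>y :: nat \<Rightarrow> nat. y t - y (t - 1)) \<in> measurable (\<Pi>\<^sub>M \<tau>\<in>UNIV. count_space UNIV) (count_space UNIV)"
      for t :: nat
    proof -
      have coord: "(\<lambda>y. y r) \<in> measurable (\<Pi>\<^sub>M \<tau>\<in>UNIV. count_space UNIV) (count_space UNIV)"
        for r :: nat
        by (rule measurable_component_singleton) simp
      \<comment> \<open>Subtraction of two coordinates is reduced to countably many cases, one for
        each value \<open>c\<close> of the first.\<close>
      have "(\<lambda>y. c - y (t - 1)) \<in>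
          measurable (\<Pi>\<^sub>M \<tau>\<in>UNIV. count_space UNIV) (count_space UNIV)" for c :: nat
        by (rule measurable_compose[OF coord]) simp
      then show ?thesis
        by (rule measurable_compose_countable[where f = "\<lambda>c y. c - y (t - 1)" and g = "\<lambda>y. y t"])
          (rule coord)
    qed
  qed (use bernoulli in \<open>auto simp: bernoulli_arrivals_def\<close>)
  then show ?thesis
    by (rule iffD1[OF indep_vars_cong, rotated -1]) (auto simp: slot_arrivals_eq fun_eq_iff)
qed

lemma distr_slot_arrivals:
  assumes "p \<in> slots {1..}"
  shows "distr M (count_space UNIV) (slot_arrivals p) =
    measure_pmf (map_pmf of_bool (bernoulli_pmf (\<rho> / real n)))"
proof -
  have "slot_arrivals p = (\<lambda>\<omega>. A (fst (fst p)) (snd (fst p)) (snd p) \<omega>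
      - A (fst (fst p)) (snd (fst p)) (snd p - 1) \<omega>)"
    using slot_arrivals_eq[OF assms] by (rule ext)
  then show ?thesis using bernoulli assms by (auto simp: bernoulli_arrivals_def slots_def)
qed

lemma measurable_slot_arrivals:
  "p \<in> slots {1..} \<Longrightarrow> slot_arrivals p \<in> measurable M (count_space UNIV)"
  using indep_slot_arrivals unfolding indep_vars_def2 by blast

lemma rate_div: "0 \<le> \<rho> / real n" "\<rho> / real n \<le> 1"
  using rate ports by (auto simp: divide_le_eq)

lemma expectation_slot_arrivals:
  fixes g :: "nat \<Rightarrow> real"
  assumes "p \<in> slots {1..}"
  shows "integrable M (\<lambda>\<omega>. g (slot_arrivals p \<omega>))"
    and "expectation (\<lambda>\<omega>. g (slot_arrivals p \<omega>)) = (1 - \<rho> / real n) * g 0 + \<rho> / real n * g 1"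
proof -
  let ?P = "map_pmf of_bool (bernoulli_pmf (\<rho> / real n)) :: nat pmf"
  note X = measurable_slot_arrivals[OF assms]
  have fin: "finite (set_pmf ?P)" by simp
  have "integrable (distr M (count_space UNIV) (slot_arrivals p)) g"
    unfolding distr_slot_arrivals[OF assms] using fin by (rule integrable_measure_pmf_finite)
  then show "integrable M (\<lambda>\<omega>. g (slot_arrivals p \<omega>))"
    by (subst (asm) integrable_distr_eq) (use X in auto)
  have "expectation (\<lambda>\<omega>. g (slot_arrivals p \<omega>)) =
      integral\<^sup>L (distr M (count_space UNIV) (slot_arrivals p)) g"
    by (subst integral_distr) (use X in auto)
  also have "\<dots> = measure_pmf.expectation (bernoulli_pmf (\<rho> / real n)) (\<lambda>x. g (of_bool x))"
    unfolding distr_slot_arrivals[OF assms] by simp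
  also have "\<dots> = (1 - \<rho> / real n) * g 0 + \<rho> / real n * g 1"
    using rate_div by (simp add: integral_bernoulli_pmf)
  finally show "expectation (\<lambda>\<omega>. g (slot_arrivals p \<omega>)) =
      (1 - \<rho> / real n) * g 0 + \<rho> / real n * g 1" .
qed

lemma AE_slot_arrivals_le_1:
  assumes "p \<in> slots {1..}"
  shows "AE \<omega> in M. slot_arrivals p \<omega> \<le> 1"
proof -
  have "AE y in distr M (count_space UNIV) (slot_arrivals p). y \<le> 1"
    unfolding distr_slot_arrivals[OF assms] by (auto simp: AE_measure_pmf_iff)
  then show ?thesis
    by (subst (asm) AE_distr_iff) (use measurable_slot_arrivals[OF assms] in auto)
qed

text \<open>The sign of \<open>s\<close> selects the tail: upper if positive, lower if negative. The
  moment generating function is bounded by \<open>exp s \<le> 1 + s + s\<^sup>2\<close> for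
  \<open>\<bar>s\<bar> \<le> 1\<close>, followed by \<open>1 + y \<le> exp y\<close>.\<close>

lemma chernoff:
  assumes J: "finite J" "J \<subseteq> slots {1..}" and s: "\<bar>s\<bar> \<le> 1"
  shows "prob {\<omega>\<in>space M. s * c \<le> s * real (\<Sum>p\<in>J. slot_arrivals p \<omega>)}
    \<le> exp (real (card J) * (\<rho> / real n) * (s + s\<^sup>2) - s * c)"
proof -
  define Z where "Z \<omega> = exp (s * real (\<Sum>p\<in>J. slot_arrivals p \<omega>))" for \<omega>
  have Z: "Z \<omega> = (\<Prod>p\<in>J. exp (s * real (slot_arrivals p \<omega>)))" for \<omega>
    using J(1) by (simp add: Z_def exp_sum sum_distrib_left)
  have indep: "indep_vars (\<lambda>_. borel) (\<lambda>p \<omega>. exp (s * real (slot_arrivals p \<omega>))) J"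
    using indep_vars_compose2[OF indep_vars_subset[OF indep_slot_arrivals J(2)],
        of "\<lambda>_ y. exp (s * real y)" "\<lambda>_. borel"] by simp
  have int: "integrable M (\<lambda>\<omega>. exp (s * real (slot_arrivals p \<omega>)))" if "p \<in> J" for p
    using expectation_slot_arrivals(1)[of p "\<lambda>y. exp (s * real y)"] J that by blast
  have Z_int: "integrable M Z"
    unfolding Z using J(1) indep int by (rule indep_vars_integrable)
  have exp_le: "exp s \<le> 1 + s + s\<^sup>2"
  proof (cases "0 \<le> s")
    case True then show ?thesis using s exp_bound[of s] by simp
  next
    case False
    \<comment> \<open>For negative \<open>s\<close> the product with \<open>1 - s\<close> is at
      least 1, and \<open>1 - s\<close> is at most \<open>exp (- s)\<close>.\<close>
    have "(1 - s) * (1 + s + s\<^sup>2) = 1 - s ^ 3"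
      by (simp add: algebra_simps power2_eq_square power3_eq_cube)
    moreover have "s ^ 3 \<le> 0" using False by (simp add: power_le_zero_eq)
    ultimately have "1 \<le> (1 - s) * (1 + s + s\<^sup>2)" by simp
    moreover have "0 < 1 + s + s\<^sup>2" using False s
      by (smt (verit) zero_less_power2 calculation mult_nonneg_nonpos)
    moreover have "1 - s \<le> exp (- s)" using exp_ge_add_one_self[of "- s"] by simp
    ultimately have "1 \<le> exp (- s) * (1 + s + s\<^sup>2)"
      by (smt (verit) mult_right_mono)
    then show ?thesis by (simp add: exp_minus field_simps)
  qed
  have "expectation Z = (\<Prod>p\<in>J. expectation (\<lambda>\<omega>. exp (s * real (slot_arrivals p \<omega>))))"
    unfolding Z using J(1) indep int by (rule indep_vars_lebesgue_integral)
  also have "\<dots> = (\<Prod>p\<in>J. 1 + \<rho> / real n * (exp s - 1))"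
    using J(2) by (intro prod.cong refl, subst expectation_slot_arrivals(2)[where g = "\<lambda>y. exp (s * real y)"])
      (auto simp: algebra_simps diff_divide_distrib)
  also have "\<dots> \<le> (\<Prod>p\<in>J. exp (\<rho> / real n * (s + s\<^sup>2)))"
  proof (intro prod_mono conjI)
    have "0 \<le> (1 - \<rho> / real n) + \<rho> / real n * exp s"
      using rate_div by (intro add_nonneg_nonneg mult_nonneg_nonneg) auto
    then show "0 \<le> 1 + \<rho> / real n * (exp s - 1)" by (simp add: algebra_simps diff_divide_distrib)
    have "\<rho> / real n * (exp s - 1) \<le> \<rho> / real n * (s + s\<^sup>2)"
      using exp_le rate_div by (intro mult_left_mono) auto
    then show "1 + \<rho> / real n * (exp s - 1) \<le> exp (\<rho> / real n * (s + s\<^sup>2))"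
      using exp_ge_add_one_self[of "\<rho> / real n * (s + s\<^sup>2)"] by linarith
  qed
  also have "\<dots> = exp (real (card J) * (\<rho> / real n) * (s + s\<^sup>2))"
    by (simp add: exp_of_nat_mult[symmetric] mult.assoc)
  finally have mgf: "expectation Z \<le> exp (real (card J) * (\<rho> / real n) * (s + s\<^sup>2))" .
  have "prob {\<omega>\<in>space M. s * c \<le> s * real (\<Sum>p\<in>J. slot_arrivals p \<omega>)} =
      prob {\<omega>\<in>space M. exp (s * c) \<le> Z \<omega>}" by (simp add: Z_def)
  also have "\<dots> \<le> expectation Z / exp (s * c)"
    by (rule integral_Markov_inequality_measure[where A = "{}"]) (use Z_int in \<open>auto simp: Z_def[abs_def]\<close>)
  also have "\<dots> \<le> exp (real (card J) * (\<rho> / real n) * (s + s\<^sup>2)) / exp (s * c)"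
    using mgf by (intro divide_right_mono) auto
  finally show ?thesis by (simp add: exp_diff)
qed

text \<open>A deterministic notion that replaces bookkeeping with sigma-algebras: functions of
  finitely many slots are automatically measurable, and functions of disjoint finite sets of slots
  are independent.\<close>

definition depends_on :: "nat set \<Rightarrow> ((nat \<Rightarrow> port_matrix) \<Rightarrow> 'b) \<Rightarrow> bool" where
  "depends_on T F \<longleftrightarrow>
    (\<forall>y z. (\<forall>t\<in>T. \<forall>i\<in>{1..n}. \<forall>j\<in>{1..n}. y t i j = z t i j) \<longrightarrow> F y = F z)"

lemma depends_on_increments:
  assumes "depends_on T F"
  shows "F (increments \<omega>) =
    F (\<lambda>t i j. restrict (\<lambda>p. slot_arrivals p \<omega>) (slots T) ((i, j), t))"
  using assms unfolding depends_on_def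
  by (elim allE impE) (auto simp: slots_def slot_arrivals_def)

text \<open>A finite product of countable discrete spaces is discrete, so every function on it is
  measurable.\<close>

lemma measurable_slots:
  assumes "finite T" and "space N = UNIV"
  shows "f \<in> measurable (\<Pi>\<^sub>M p\<in>slots T. count_space (UNIV :: nat set)) N"
proof -
  have "finite (slots T)" using assms by (simp add: slots_def)
  then have "(\<Pi>\<^sub>M p\<in>slots T. count_space (UNIV :: nat set)) = count_space (\<Pi>\<^sub>E p\<in>slots T. UNIV)"
    by (intro count_space_PiM_finite) auto
  then show ?thesis using assms(2) by simp
qed

lemma measurable_increments:
  assumes "depends_on T F" and "finite T" and "T \<subseteq> {1..}" and "space N = UNIV"
  shows "(\<lambda>\<omega>. F (increments \<omega>)) \<in> measurable M N"
proof -
  have "(\<lambda>\<omega>. restrict (\<lambda>p. slot_arrivals p \<omega>) (slots T)) \<in>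
      measurable M (\<Pi>\<^sub>M p\<in>slots T. count_space UNIV)"
    using assms(3) by (intro measurable_restrict measurable_slot_arrivals) (auto simp: slots_def)
  from measurable_compose[OF this measurable_slots[OF assms(2,4)]]
  show ?thesis unfolding depends_on_increments[OF assms(1)] .
qed

lemma indep_var_increments:
  assumes F: "depends_on S F" "finite S" "S \<subseteq> {1..}" "space N = UNIV"
    and G: "depends_on T G" "finite T" "T \<subseteq> {1..}" "space N' = UNIV"
    and disj: "S \<inter> T = {}"
  shows "indep_var N (\<lambda>\<omega>. F (increments \<omega>)) N' (\<lambda>\<omega>. G (increments \<omega>))"
proof -
  have "indep_var (\<Pi>\<^sub>M p\<in>slots S. count_space UNIV) (\<lambda>\<omega>. restrict (\<lambda>p. slot_arrivals p \<omega>) (slots S))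
      (\<Pi>\<^sub>M p\<in>slots T. count_space UNIV) (\<lambda>\<omega>. restrict (\<lambda>p. slot_arrivals p \<omega>) (slots T))"
    by (rule indep_var_restrict[OF indep_slot_arrivals]) (use F G disj in \<open>auto simp: slots_def\<close>)
  from indep_var_compose[OF this measurable_slots[OF F(2,4)] measurable_slots[OF G(2,4)]]
  show ?thesis unfolding depends_on_increments[OF F(1)] depends_on_increments[OF G(1)] comp_def .
qed

end

section \<open>The expected backlog\<close>

lemma queue_le_arrivals: "queue n \<pi> a (Suc s) i j \<le> arrivals (new_arrivals n a) 0 s i j"
proof (induction s)
  case 0
  show ?case using queue_1[of n \<pi> a i j] by simp
next
  case (Suc s)
  then show ?case by (simp add: queue_Suc_nat arrivals_Suc)
qed

lemma queue_cong:
  assumes "\<And>t. t < s \<Longrightarrow> new_arrivals n a (Suc t) = new_arrivals n a' (Suc t)"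
  shows "queue n \<pi> a (Suc s) = queue n \<pi> a' (Suc s)"
proof -
  have "switch_run n \<pi> a s = switch_run n \<pi> a' s"
    using assms by (induction s) (simp_all add: Let_def)
  then show ?thesis by (simp add: queue_def)
qed

lemma integral_double_sum:
  fixes f :: "'i \<Rightarrow> 'j \<Rightarrow> 'a \<Rightarrow> real"
  assumes "\<And>i j. i \<in> I \<Longrightarrow> j \<in> J \<Longrightarrow> integrable M (f i j)"
  shows "(\<integral>\<omega>. (\<Sum>i\<in>I. \<Sum>j\<in>J. f i j \<omega>) \<partial>M) = (\<Sum>i\<in>I. \<Sum>j\<in>J. \<integral>\<omega>. f i j \<omega> \<partial>M)"
  using assms by (simp add: Bochner_Integration.integral_sum Bochner_Integration.integrable_sum)

section \<open>Integrability of arrivals and queues\<close>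

context bernoulli_switch
begin

lemma depends_on_mono: "depends_on S F \<Longrightarrow> S \<subseteq> T \<Longrightarrow> depends_on T F"
  unfolding depends_on_def by blast

lemma depends_on_compose: "depends_on T F \<Longrightarrow> depends_on T (\<lambda>y. g (F y))"
  unfolding depends_on_def by (intro allI impI arg_cong[where f = g]) blast

lemma sum_slot_arrivals:
  "(\<Sum>p\<in>P \<times> {Suc s..<Suc t}. slot_arrivals p \<omega>) = (\<Sum>(i, j)\<in>P. arrivals (increments \<omega>) s t i j)"
  unfolding sum.cartesian_product' arrivals_def slot_arrivals_def
  by (intro sum.cong refl) (simp add: case_prod_beta sum.shift_bounds_Suc_ivl del: sum.op_ivl_Suc)

lemma expectation_arrivals:
  assumes "i \<in> {1..n}" and "j \<in> {1..n}"
  shows "integrable M (\<lambda>\<omega>. real (arrivals (increments \<omega>) s t i j))"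
    and "expectation (\<lambda>\<omega>. real (arrivals (increments \<omega>) s t i j)) = real (t - s) * (\<rho> / real n)"
proof -
  have p: "((i, j), Suc r) \<in> slots {1..}" for r using assms by (simp add: slots_def)
  have eq: "real (arrivals (increments \<omega>) s t i j) = (\<Sum>r=s..<t. real (slot_arrivals ((i, j), Suc r) \<omega>))" for \<omega>
    by (simp add: arrivals_def slot_arrivals_def)
  note E = expectation_slot_arrivals[OF p, where g = real]
  show "integrable M (\<lambda>\<omega>. real (arrivals (increments \<omega>) s t i j))"
    unfolding eq using E(1) by (intro Bochner_Integration.integrable_sum)
  show "expectation (\<lambda>\<omega>. real (arrivals (increments \<omega>) s t i j)) = real (t - s) * (\<rho> / real n)"
    unfolding eq using E by (simp add: Bochner_Integration.integral_sum)
qed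

text \<open>After \<open>s\<close> slots a queue is a function of finitely many integer variables,
  hence measurable however the policy is defined, and the arrivals dominate it.\<close>

lemma integrable_queue:
  assumes "i \<in> {1..n}" and "j \<in> {1..n}"
  shows "integrable M (\<lambda>\<omega>. real (queue n \<pi> (\<lambda>k l t. A k l t \<omega>) (Suc s) i j))"
proof (rule Bochner_Integration.integrable_bound)
  show "integrable M (\<lambda>\<omega>. real (arrivals (increments \<omega>) 0 s i j))"
    by (rule expectation_arrivals(1)[OF assms])
  show "AE \<omega> in M. norm (real (queue n \<pi> (\<lambda>k l t. A k l t \<omega>) (Suc s) i j))
      \<le> norm (real (arrivals (increments \<omega>) 0 s i j))"
    using queue_le_arrivals by (simp add: increments_def)
  \<comment> \<open>The run takes cumulative paths, whereas \<open>depends_on\<close> speaks of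
    increments. Partial sums rebuild a path with the same \<open>new_arrivals\<close>.\<close>
  define F where "F y = real (queue n \<pi> (\<lambda>i j t. \<Sum>r=1..t. y r i j) (Suc s) i j)" for y
  have new: "new_arrivals n (\<lambda>i j t. \<Sum>r=1..t. y r i j) (Suc t) =
      (\<lambda>i j. if i \<in> {1..n} \<and> j \<in> {1..n} then y (Suc t) i j else 0)" for y :: "nat \<Rightarrow> port_matrix" and t
    by (intro ext) (simp add: new_arrivals_def)
  have "depends_on {1..s} F"
    unfolding depends_on_def
  proof (intro allI impI)
    fix y z :: "nat \<Rightarrow> port_matrix"
    assume yz: "\<forall>t\<in>{1..s}. \<forall>i\<in>{1..n}. \<forall>j\<in>{1..n}. y t i j = z t i j"
    have "queue n \<pi> (\<lambda>i j t. \<Sum>r=1..t. y r i j) (Suc s) = queue n \<pi> (\<lambda>i j t. \<Sum>r=1..t. z r i j) (Suc s)"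
    proof (rule queue_cong)
      fix t assume "t < s"
      then show "new_arrivals n (\<lambda>i j t. \<Sum>r=1..t. y r i j) (Suc t) =
          new_arrivals n (\<lambda>i j t. \<Sum>r=1..t. z r i j) (Suc t)"
        unfolding new using yz by (intro ext) auto
    qed
    then show "F y = F z" by (simp add: F_def)
  qed
  then have "(\<lambda>\<omega>. F (increments \<omega>)) \<in> borel_measurable M"
    by (rule measurable_increments) auto
  moreover have "F (increments \<omega>) = real (queue n \<pi> (\<lambda>k l t. A k l t \<omega>) (Suc s) i j)" for \<omega>
  proof -
    have "queue n \<pi> (\<lambda>i j t. \<Sum>r=1..t. increments \<omega> r i j) (Suc s) = queue n \<pi> (\<lambda>k l t. A k l t \<omega>) (Suc s)"
      by (rule queue_cong, unfold new) (simp add: increments_def new_arrivals_def fun_eq_iff)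
    then show ?thesis by (simp add: F_def)
  qed
  ultimately show "(\<lambda>\<omega>. real (queue n \<pi> (\<lambda>k l t. A k l t \<omega>) (Suc s) i j)) \<in> borel_measurable M"
    by simp
qed

lemma AE_increments_le_1:
  "AE \<omega> in M. \<forall>t. \<forall>i\<in>{1..n}. \<forall>j\<in>{1..n}. increments \<omega> (Suc t) i j \<le> 1"
proof -
  have "AE \<omega> in M. \<forall>p\<in>slots {1..}. slot_arrivals p \<omega> \<le> 1"
    unfolding AE_ball_countable[OF countableI_type] using AE_slot_arrivals_le_1 by blast
  then show ?thesis
  proof (rule AE_mp[OF _ AE_I2], intro impI allI ballI)
    fix \<omega> t i j
    assume "\<forall>p\<in>slots {1..}. slot_arrivals p \<omega> \<le> 1" "i \<in> {1..n}" "j \<in> {1..n}"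
    then show "increments \<omega> (Suc t) i j \<le> 1"
      by (auto simp: slots_def slot_arrivals_def dest!: bspec[of _ _ "((i, j), Suc t)"])
  qed
qed

end

section \<open>Drift of the backlog and the mean queue size\<close>

locale batched_switch = bernoulli_switch M n \<rho> A + batching n d w
  for M :: "'w measure" and n :: nat and \<rho> :: real
    and A :: "nat \<Rightarrow> nat \<Rightarrow> nat \<Rightarrow> 'w \<Rightarrow> nat" and d w :: nat
begin

text \<open>These slots are disjoint from \<open>{1..k * b}\<close>, which determine
  \<open>backlog y k\<close>; hence the failure of a batch is independent of the backlog it
  meets.\<close>

lemma depends_on_good_batch:
  "depends_on {Suc (k * b)..Suc k * b} (\<lambda>y. good_batch y k)"
  unfolding depends_on_def
proof (intro allI impI)
  fix y z :: "nat \<Rightarrow> port_matrix"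
  assume yz: "\<forall>t\<in>{Suc (k * b)..Suc k * b}. \<forall>i\<in>{1..n}. \<forall>j\<in>{1..n}. y t i j = z t i j"
  have arr: "arrivals y (k * b) t i j = arrivals z (k * b) t i j"
    if "t \<le> Suc k * b" "i \<in> {1..n}" "j \<in> {1..n}" for t i j
    unfolding arrivals_def using yz that by (intro sum.cong refl) auto
  have "k * b + d + v \<le> Suc k * b" if "v < n * w" for v
    using that by (simp add: batch_length_def)
  note arr1 = arr[OF this] and arr2 = arr[OF order_refl]
  have "(\<Sum>j=1..n. arrivals y (k * b) (Suc k * b) i j) = (\<Sum>j=1..n. arrivals z (k * b) (Suc k * b) i j)"
    if "i \<in> {1..n}" for i using that by (intro sum.cong refl arr2)
  moreover have "(\<Sum>i=1..n. arrivals y (k * b) (Suc k * b) i j) = (\<Sum>i=1..n. arrivals z (k * b) (Suc k * b) i j)"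
    if "j \<in> {1..n}" for j using that by (intro sum.cong refl arr2)
  ultimately show "good_batch y k = good_batch z k"
    unfolding good_batch_def using arr1 by (simp only: cong: ball_cong imp_cong)
qed

lemma depends_on_backlog: "depends_on {1..k * b} (\<lambda>y. backlog y k)"
proof (induction k)
  case (Suc k)
  have "depends_on {1..Suc k * b} (\<lambda>y. backlog y k)"
    by (rule depends_on_mono[OF Suc]) auto
  moreover have "depends_on {1..Suc k * b} (\<lambda>y. good_batch y k)"
    by (rule depends_on_mono[OF depends_on_good_batch]) auto
  ultimately show ?case
    unfolding depends_on_def
  proof (intro allI impI)
    fix y z :: "nat \<Rightarrow> port_matrix"
    assume *: "\<forall>y z. (\<forall>t\<in>{1..Suc k * b}. \<forall>i\<in>{1..n}. \<forall>j\<in>{1..n}. y t i j = z t i j) \<longrightarrow>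
        backlog y k = backlog z k"
      "\<forall>y z. (\<forall>t\<in>{1..Suc k * b}. \<forall>i\<in>{1..n}. \<forall>j\<in>{1..n}. y t i j = z t i j) \<longrightarrow>
        good_batch y k = good_batch z k"
      and yz: "\<forall>t\<in>{1..Suc k * b}. \<forall>i\<in>{1..n}. \<forall>j\<in>{1..n}. y t i j = z t i j"
    show "backlog y (Suc k) = backlog z (Suc k)"
      using *(1)[rule_format, of y z, OF yz[rule_format]]
        *(2)[rule_format, of y z, OF yz[rule_format]] by simp
  qed
qed (simp add: depends_on_def)

lemma backlog_le: "backlog y k \<le> k * b"
  by (induction k) auto

text \<open>With \<open>z = 1 + 1 / b\<close> a batch divides \<open>z ^ backlog\<close> by
  \<open>z\<close> unless the backlog is 0, and a bad batch multiplies it by at most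
  \<open>z ^ b \<le> 3\<close>. The drift \<open>1 - 1 / z = 1 / (b + 1)\<close> against a gain of
  order \<open>p\<close> keeps the mean of \<open>z ^ backlog - 1\<close> at order
  \<open>b * p\<close>. Bernoulli's inequality costs one more factor \<open>b\<close>.\<close>

lemma expectation_backlog:
  assumes fail: "\<And>k. prob {\<omega>\<in>space M. \<not> good_batch (increments \<omega>) k} \<le> p" and p: "8 * real b * p \<le> 1"
  shows "integrable M (\<lambda>\<omega>. real (backlog (increments \<omega>) k))"
    and "expectation (\<lambda>\<omega>. real (backlog (increments \<omega>) k)) \<le> 8 * (real b)\<^sup>2 * p"
proof -
  define z where "z = 1 + 1 / real b"
  have b: "real b \<ge> 1" using b_pos by linarith
  have z: "1 < z" using b by (simp add: z_def)
  have p_ge: "0 \<le> p" using fail[of 0] measure_nonneg order_trans by blast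
  have z_b: "z ^ b \<le> 3"
  proof -
    have "z ^ b \<le> exp (1 / real b) ^ b"
      using z exp_ge_add_one_self[of "1 / real b"] by (intro power_mono) (auto simp: z_def)
    also have "\<dots> = exp 1" using b by (simp add: exp_of_nat_mult[symmetric])
    also have "\<dots> \<le> 3" by (rule exp_le)
    finally show ?thesis .
  qed
  define W where "W k y = z ^ backlog y k - 1" for k y
  define B where "B k y = (of_bool (\<not> good_batch y k) :: real)" for k y
  have dep_W: "depends_on {1..k * b} (W k)" for k
    unfolding W_def by (rule depends_on_compose[OF depends_on_backlog])
  have dep_B: "depends_on {Suc (k * b)..Suc k * b} (B k)" for k
    unfolding B_def by (rule depends_on_compose[OF depends_on_good_batch])
  have meas_W: "(\<lambda>\<omega>. W k (increments \<omega>)) \<in> borel_measurable M" for k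
    by (rule measurable_increments[OF dep_W]) auto
  have meas_B: "(\<lambda>\<omega>. B k (increments \<omega>)) \<in> borel_measurable M" for k
    by (rule measurable_increments[OF dep_B]) auto
  have W_ge: "0 \<le> W k y" for k y using z by (simp add: W_def)
  have int_W: "integrable M (\<lambda>\<omega>. W k (increments \<omega>))" for k
  proof (rule integrable_const_bound)
    show "AE \<omega> in M. norm (W k (increments \<omega>)) \<le> z ^ (k * b)"
    proof (rule AE_I2)
      fix \<omega>
      have "z ^ backlog (increments \<omega>) k \<le> z ^ (k * b)"
        using z backlog_le by (intro power_increasing) auto
      then show "norm (W k (increments \<omega>)) \<le> z ^ (k * b)"
        using W_ge[of k "increments \<omega>"] by (simp add: W_def)
    qed
  qed (rule meas_W)
  have int_B: "integrable M (\<lambda>\<omega>. B k (increments \<omega>))" for k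
    by (rule integrable_const_bound[where B = 1]) (use meas_B in \<open>auto simp: B_def\<close>)
  have E_B: "expectation (\<lambda>\<omega>. B k (increments \<omega>)) \<le> p" for k
  proof -
    have "{\<omega>\<in>space M. \<not> good_batch (increments \<omega>) k} = (\<lambda>\<omega>. B k (increments \<omega>)) -` {1} \<inter> space M"
      by (auto simp: B_def)
    then have "{\<omega>\<in>space M. \<not> good_batch (increments \<omega>) k} \<in> events"
      using measurable_sets[OF meas_B, of "{1}" k] by simp
    moreover have "expectation (\<lambda>\<omega>. B k (increments \<omega>)) =
        expectation (indicator {\<omega>\<in>space M. \<not> good_batch (increments \<omega>) k})"
      by (intro Bochner_Integration.integral_cong refl) (auto simp: B_def indicator_def)
    ultimately show ?thesis using fail[of k] by simp
  qed
  \<comment> \<open>Subtracting 1 makes \<open>W\<close> vanish at backlog 0, where no division by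
    \<open>z\<close> takes place. Both coefficients 2 are \<open>3 - 1\<close>, from
    \<open>z ^ b \<le> 3\<close>.\<close>
  have step: "W (Suc k) y \<le> W k y / z + (2 / z) * (W k y * B k y) + 2 * B k y" for k y
  proof (cases "backlog y k")
    case 0
    then show ?thesis using z_b by (simp add: W_def B_def)
  next
    case (Suc N)
    have W: "W k y = z * z ^ N - 1" by (simp add: W_def Suc)
    show ?thesis
    proof (cases "good_batch y k")
      case True
      then show ?thesis using z by (simp add: W B_def W_def[of "Suc k"] Suc field_simps)
    next
      case False
      have "z ^ N * z ^ b \<le> z ^ N * 3" using z z_b by (intro mult_left_mono) auto
      moreover have "W k y / z + (2 / z) * (W k y * B k y) + 2 * B k y = 3 * z ^ N - 3 / z + 2"
        using False z by (simp add: W B_def field_simps)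
      moreover have "W (Suc k) y = z ^ N * z ^ b - 1"
        using False by (simp add: W_def[of "Suc k"] Suc power_add)
      moreover have "3 / z \<le> 3" using z by (simp add: field_simps)
      ultimately show ?thesis by linarith
    qed
  qed
  have indep: "indep_var borel (\<lambda>\<omega>. W k (increments \<omega>)) borel (\<lambda>\<omega>. B k (increments \<omega>))" for k
    by (rule indep_var_increments[OF dep_W _ _ _ dep_B]) auto
  have E_W: "expectation (\<lambda>\<omega>. W k (increments \<omega>)) \<le> 8 * real b * p" for k
  proof (induction k)
    case 0
    show ?case using p_ge by (simp add: W_def)
  next
    case (Suc k)
    let ?e = "expectation (\<lambda>\<omega>. W k (increments \<omega>))"
    note WB = indep_var_integrable[OF indep int_W int_B] indep_var_lebesgue_integral[OF indep int_W int_B]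
    have e: "0 \<le> ?e" using W_ge by (intro integral_nonneg_AE) auto
    have B_ge: "0 \<le> expectation (\<lambda>\<omega>. B k (increments \<omega>))"
      by (intro integral_nonneg_AE) (auto simp: B_def)
    have "expectation (\<lambda>\<omega>. W (Suc k) (increments \<omega>)) \<le>
        expectation (\<lambda>\<omega>. W k (increments \<omega>) / z + (2 / z) * (W k (increments \<omega>) * B k (increments \<omega>)) + 2 * B k (increments \<omega>))"
      using int_W int_B WB(1) step
      by (intro integral_mono Bochner_Integration.integrable_add integrable_divide_zero
          Bochner_Integration.integrable_mult_right) auto
    also have "\<dots> = ?e / z + (2 / z) * (?e * expectation (\<lambda>\<omega>. B k (increments \<omega>)))
        + 2 * expectation (\<lambda>\<omega>. B k (increments \<omega>))"
      using int_W int_B WB by (simp add: integral_add)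
    also have "\<dots> \<le> 8 * real b * p / z + (2 / z) * (8 * real b * p * p) + 2 * p"
      using Suc E_B[of k] e B_ge z p_ge
      by (intro add_mono mult_left_mono mult_mono divide_right_mono) auto
    also have "\<dots> \<le> 8 * real b * p"
    proof -
      have inv: "1 / z = real b / (real b + 1)" using b by (simp add: z_def field_simps)
      have "8 * real b * p / z + (2 / z) * (8 * real b * p * p) + 2 * p
          = (8 * real b * p + 2 * (8 * real b * p) * p) * (1 / z) + 2 * p"
        by (simp add: field_simps add_divide_distrib)
      \<comment> \<open>The hypothesis \<open>8 * b * p \<le> 1\<close> makes the quadratic term
        linear. What remains amounts to \<open>4 * b + 2 \<le> 8 * b\<close>, multiplied by
        \<open>p\<close>.\<close>
      also have "\<dots> \<le> (8 * real b * p + 2 * 1 * p) * (1 / z) + 2 * p"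
        using p p_ge z by (intro add_mono mult_right_mono mult_left_mono) auto
      also have "\<dots> \<le> 8 * real b * p"
      proof -
        have "(8 * real b * p + 2 * p) * real b + 2 * p * (real b + 1) \<le> 8 * real b * p * (real b + 1)"
          using mult_left_mono[OF b p_ge] p_ge by (simp add: algebra_simps)
        then show ?thesis unfolding inv using b by (simp add: field_simps)
      qed
      finally show ?thesis .
    qed
    finally show ?case .
  qed
  have N_le: "real (backlog y k) \<le> real b * W k y" for y
  proof -
    have "1 + real (backlog y k) * (1 / real b) \<le> (1 + 1 / real b) ^ backlog y k"
      by (rule Bernoulli_inequality) (rule order_trans[of _ 0], simp_all)
    then have "real (backlog y k) / real b \<le> W k y" by (simp add: W_def z_def)
    then show ?thesis using b by (simp add: field_simps)
  qed
  have meas: "(\<lambda>\<omega>. real (backlog (increments \<omega>) k)) \<in> borel_measurable M"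
    by (rule measurable_increments[OF depends_on_compose[OF depends_on_backlog]]) auto
  show int: "integrable M (\<lambda>\<omega>. real (backlog (increments \<omega>) k))"
    by (rule integrable_const_bound[where B = "real (k * b)"])
      (use meas backlog_le in \<open>auto simp del: of_nat_mult\<close>)
  have "expectation (\<lambda>\<omega>. real (backlog (increments \<omega>) k)) \<le> expectation (\<lambda>\<omega>. real b * W k (increments \<omega>))"
    using int int_W N_le by (intro integral_mono) auto
  also have "\<dots> \<le> real b * (8 * real b * p)" using E_W by (simp add: mult_left_mono)
  finally show "expectation (\<lambda>\<omega>. real (backlog (increments \<omega>) k)) \<le> 8 * (real b)\<^sup>2 * p"
    by (simp add: power2_eq_square algebra_simps)
qed

text \<open>Since \<open>\<rho> \<le> 1\<close>, the mean arrivals in the first \<open>u\<close>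
  slots of the period are at most \<open>n * u\<close>, so the bracket of
  \<open>total_queue_bound\<close> contributes one \<open>n * d\<close> and the leftovers the other.
  The factor 9 is 8 from the backlog plus 1 for the charge of a bad batch.\<close>

lemma expectation_total_queue:
  assumes fail: "\<And>k. prob {\<omega>\<in>space M. \<not> good_batch (increments \<omega>) k} \<le> p" and p: "8 * real b * p \<le> 1"
  shows "(\<Sum>i=1..n. \<Sum>j=1..n. expectation (\<lambda>\<omega>. real (queue n batch_policy (\<lambda>k l t. A k l t \<omega>) (Suc s) i j)))
    \<le> 9 * (real n)\<^sup>2 * (real b)\<^sup>2 * p + 2 * real n * real d"
proof -
  define k u where "k = s div b" and "u = s mod b"
  have s: "s = k * b + u" and u: "u < b" using b_pos by (simp_all add: k_def u_def)
  have b: "real b \<ge> 1" using b_pos by linarith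
  have p_ge: "0 \<le> p" using fail[of 0] measure_nonneg order_trans by blast
  let ?Q = "\<lambda>i j \<omega>. real (queue n batch_policy (\<lambda>k l t. A k l t \<omega>) (Suc s) i j)"
  let ?A = "\<lambda>i j \<omega>. real (arrivals (increments \<omega>) (k * b) s i j)"
  let ?B = "\<lambda>\<omega>. of_bool (\<not> good_batch (increments \<omega>) k) :: real"
  let ?N = "\<lambda>\<omega>. real (backlog (increments \<omega>) k)"
  have int_Q: "integrable M (\<lambda>\<omega>. \<Sum>i=1..n. \<Sum>j=1..n. ?Q i j \<omega>)"
    using integrable_queue by (intro Bochner_Integration.integrable_sum)
  have int_A: "integrable M (\<lambda>\<omega>. \<Sum>i=1..n. \<Sum>j=1..n. ?A i j \<omega>)"
    using expectation_arrivals(1) by (intro Bochner_Integration.integrable_sum)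
  have "(\<lambda>\<omega>. good_batch (increments \<omega>) k) \<in> measurable M (count_space UNIV)"
    by (rule measurable_increments[OF depends_on_good_batch]) auto
  then have ev: "{\<omega>\<in>space M. \<not> good_batch (increments \<omega>) k} \<in> events" by measurable
  have B_eq: "?B \<omega> = indicator {\<omega>\<in>space M. \<not> good_batch (increments \<omega>) k} \<omega>" if "\<omega> \<in> space M" for \<omega>
    using that by (simp add: indicator_def)
  have "integrable M (indicator {\<omega>\<in>space M. \<not> good_batch (increments \<omega>) k} :: 'w \<Rightarrow> real)"
    by (rule integrable_real_indicator[OF ev]) (simp add: less_top[symmetric])
  then have int_B: "integrable M ?B"
    by (subst Bochner_Integration.integrable_cong[OF refl B_eq])
  have E_B: "expectation ?B \<le> p"
    using ev fail[of k] by (subst Bochner_Integration.integral_cong[OF refl B_eq]) auto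
  note E_N = expectation_backlog[OF fail p]
  have E_A: "expectation (\<lambda>\<omega>. \<Sum>i=1..n. \<Sum>j=1..n. ?A i j \<omega>) \<le> real n * real u"
  proof -
    have "expectation (\<lambda>\<omega>. \<Sum>i=1..n. \<Sum>j=1..n. ?A i j \<omega>) =
        (\<Sum>i=1..n. \<Sum>j=1..n. expectation (?A i j))"
      by (rule integral_double_sum) (rule expectation_arrivals(1))
    also have "\<dots> = (\<Sum>i=1..n. \<Sum>j=1..n. real u * (\<rho> / real n))"
      by (intro sum.cong refl, subst expectation_arrivals(2)) (simp_all add: s)
    also have "\<dots> = real n * real u * \<rho>" using ports by simp
    also have "\<dots> \<le> real n * real u" using rate by (intro mult_left_le) auto
    finally show ?thesis .
  qed
  have "(\<Sum>i=1..n. \<Sum>j=1..n. expectation (?Q i j)) = expectation (\<lambda>\<omega>. \<Sum>i=1..n. \<Sum>j=1..n. ?Q i j \<omega>)"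
    by (rule integral_double_sum[symmetric]) (rule integrable_queue)
  also have "\<dots> \<le> expectation (\<lambda>\<omega>. (real n)\<^sup>2 * ?N \<omega> + real n * real d
      + ((\<Sum>i=1..n. \<Sum>j=1..n. ?A i j \<omega>) - real n * (real u - real d)) + real n * real b * ?B \<omega>)"
  proof (rule integral_mono_AE)
    show "AE \<omega> in M. (\<Sum>i=1..n. \<Sum>j=1..n. ?Q i j \<omega>) \<le> (real n)\<^sup>2 * ?N \<omega> + real n * real d
      + ((\<Sum>i=1..n. \<Sum>j=1..n. ?A i j \<omega>) - real n * (real u - real d)) + real n * real b * ?B \<omega>"
      using AE_increments_le_1
    proof (rule AE_mp[OF _ AE_I2], intro impI)
      fix \<omega>
      assume "\<forall>t. \<forall>i\<in>{1..n}. \<forall>j\<in>{1..n}. increments \<omega> (Suc t) i j \<le> 1"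
      then show "(\<Sum>i=1..n. \<Sum>j=1..n. ?Q i j \<omega>) \<le> (real n)\<^sup>2 * ?N \<omega> + real n * real d
        + ((\<Sum>i=1..n. \<Sum>j=1..n. ?A i j \<omega>) - real n * (real u - real d)) + real n * real b * ?B \<omega>"
        using total_queue_bound[OF increments_def[of \<omega>] _ u, of k] unfolding s of_nat_sum by blast
    qed
  qed (use int_Q int_A int_B E_N(1) in auto)
  also have "\<dots> = (real n)\<^sup>2 * expectation ?N + real n * real d
      + (expectation (\<lambda>\<omega>. \<Sum>i=1..n. \<Sum>j=1..n. ?A i j \<omega>) - real n * (real u - real d))
      + real n * real b * expectation ?B"
    using int_A int_B E_N(1) by (simp add: prob_space)
  also have "\<dots> \<le> (real n)\<^sup>2 * (8 * (real b)\<^sup>2 * p) + real n * real d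
      + (real n * real u - real n * (real u - real d)) + real n * real b * p"
    using E_A E_B E_N(2) by (intro add_mono diff_mono mult_left_mono) auto
  also have "\<dots> = 8 * (real n)\<^sup>2 * (real b)\<^sup>2 * p + 2 * real n * real d + real n * real b * p"
    by (simp add: algebra_simps)
  also have "real n * real b * p \<le> (real n)\<^sup>2 * (real b)\<^sup>2 * p"
    using p_ge b ports by (intro mult_right_mono mult_mono self_le_power) auto
  finally show ?thesis by linarith
qed

end

section \<open>The probability of a bad batch\<close>

lemma (in bernoulli_switch) chernoff_arrivals:
  assumes P: "P \<subseteq> {1..n} \<times> {1..n}" and \<theta>: "\<bar>\<theta>\<bar> \<le> 1"
  shows "{\<omega>\<in>space M. \<theta> * c \<le> \<theta> * (\<Sum>(i, j)\<in>P. real (arrivals (increments \<omega>) s t i j))} \<in> events" (is "?E \<in> _")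
    and "prob {\<omega>\<in>space M. \<theta> * c \<le> \<theta> * (\<Sum>(i, j)\<in>P. real (arrivals (increments \<omega>) s t i j))}
      \<le> exp (real (card P * (t - s)) * (\<rho> / real n) * (\<theta> + \<theta>\<^sup>2) - \<theta> * c)"
proof -
  have fin: "finite P" using P by (rule finite_subset) simp
  have "(\<lambda>\<omega>. real (arrivals (increments \<omega>) s t (fst p) (snd p))) \<in> borel_measurable M" if "p \<in> P" for p
    using that P by (intro borel_measurable_integrable expectation_arrivals(1)) auto
  then have "(\<lambda>\<omega>. \<theta> * (\<Sum>p\<in>P. real (arrivals (increments \<omega>) s t (fst p) (snd p)))) \<in> borel_measurable M"
    by (intro borel_measurable_times borel_measurable_sum) auto
  then show "?E \<in> events" unfolding case_prod_beta by measurable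
  have eq: "(\<Sum>(i, j)\<in>P. real (arrivals (increments \<omega>) s t i j)) =
      real (\<Sum>p\<in>P \<times> {Suc s..<Suc t}. slot_arrivals p \<omega>)" for \<omega>
    unfolding sum_slot_arrivals by (simp add: case_prod_beta)
  have "prob ?E \<le> exp (real (card (P \<times> {Suc s..<Suc t})) * (\<rho> / real n) * (\<theta> + \<theta>\<^sup>2) - \<theta> * c)"
    unfolding eq by (rule chernoff) (use fin P \<theta> in \<open>auto simp: slots_def\<close>)
  then show "prob ?E \<le> exp (real (card P * (t - s)) * (\<rho> / real n) * (\<theta> + \<theta>\<^sup>2) - \<theta> * c)"
    by (simp add: card_cartesian_product)
qed

text \<open>
  Both tail estimates below are optimised at \<open>\<theta> = \<delta> / (2\<mu>)\<close> for the deviation \<open>\<delta>\<close> and an upper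
  bound \<open>\<mu>\<close> of the mean: \<open>\<delta> = rl/4\<close>, \<open>\<mu> = r\<^sup>2l\<close> for a single queue,
  \<open>\<delta> = nl/2\<close>, \<open>\<mu> = n\<^sup>2l\<close> for a line.
\<close>

lemma queue_exponent:
  fixes n r l m v :: real
  assumes n: "2 \<le> n" and r: "2 \<le> r" "n \<le> r\<^sup>2" and l: "4 \<le> l" and v: "0 \<le> v"
    and m: "m = n * r * l + v" "m \<le> n\<^sup>2 * l"
  defines "\<theta> \<equiv> - 1 / (8 * r)"
  shows "m * ((1 - 1 / n) / n) * (\<theta> + \<theta>\<^sup>2) - \<theta> * (v / n + 1) \<le> - l / 64"
proof -
  define \<mu> where "\<mu> = m * ((1 - 1 / n) / n)"
  have m_n: "m / n = r * l + v / n" using n by (simp add: m(1) field_simps)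
  have m_n2: "m / n\<^sup>2 \<le> l" using m(2) n by (simp add: field_simps)
  have \<mu>: "\<mu> = m / n - m / n\<^sup>2"
    using n by (simp add: \<mu>_def field_simps power2_eq_square)
  have rl: "2 * l \<le> r * l" "8 \<le> r * l" using r l mult_mono[of 2 r 4 l] by auto
  \<comment> \<open>The mean exceeds \<open>v / n\<close> by the head start \<open>r * l\<close>
    less \<open>m / n\<^sup>2 \<le> l\<close>, the deficit due to the load below 1. As
    \<open>r \<ge> 2\<close> and \<open>r * l \<ge> 8\<close>, the losses \<open>l\<close> and 1
    take at most 5/8 of \<open>r * l\<close>.\<close>
  have "r * l / 4 \<le> \<mu> - (v / n + 1)" using m_n m_n2 rl unfolding \<mu> by linarith
  then have "r * l / 4 / (8 * r) \<le> (\<mu> - (v / n + 1)) / (8 * r)"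
    using r by (intro divide_right_mono) auto
  then have dev: "l / 32 \<le> (\<mu> - (v / n + 1)) / (8 * r)" using r by simp
  have "0 \<le> m" using m n r l v by simp
  then have "\<mu> \<le> m / n" unfolding \<mu> using n by simp
  also have "\<dots> \<le> n\<^sup>2 * l / n" using m(2) n by (intro divide_right_mono) auto
  also have "\<dots> = n * l" using n by (simp add: power2_eq_square)
  \<comment> \<open>This is where \<open>r\<close> has to be at least the square root of
    \<open>n\<close>: the mean, which also bounds the variance of the count, may reach order
    \<open>n * l\<close>.\<close>
  also have "\<dots> \<le> r\<^sup>2 * l" using r l by (intro mult_right_mono) auto
  finally have "\<mu> / (8 * r)\<^sup>2 \<le> r\<^sup>2 * l / (8 * r)\<^sup>2" by (intro divide_right_mono) auto
  also have "\<dots> = l / 64" using r by (simp add: power2_eq_square)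
  finally have "\<mu> / (8 * r)\<^sup>2 \<le> l / 64" .
  moreover have "\<mu> * (\<theta> + \<theta>\<^sup>2) - \<theta> * (v / n + 1) =
      \<mu> / (8 * r)\<^sup>2 - (\<mu> - (v / n + 1)) / (8 * r)"
    by (simp add: \<theta>_def power_divide diff_divide_distrib algebra_simps)
  ultimately show ?thesis using dev unfolding \<mu>_def by linarith
qed

lemma line_exponent:
  fixes n l :: real
  assumes n: "2 \<le> n" and l: "4 \<le> l"
  defines "\<theta> \<equiv> 1 / (4 * n)"
  shows "n * (n\<^sup>2 * l) * ((1 - 1 / n) / n) * (\<theta> + \<theta>\<^sup>2) - \<theta> * (n\<^sup>2 * l - n) \<le> - l / 64"
proof -
  have \<mu>: "n * (n\<^sup>2 * l) * ((1 - 1 / n) / n) = n\<^sup>2 * l - n * l"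
    using n by (simp add: field_simps power2_eq_square)
  \<comment> \<open>The term \<open>- l / 4\<close> comes from the shortfall \<open>n * l\<close> of
    the mean below \<open>n\<^sup>2 * l\<close>, \<open>l / 16\<close> from the quadratic term, and
    \<open>1 / 4\<close> from the reserve \<open>n\<close>.\<close>
  have "(n\<^sup>2 * l - n * l) * (\<theta> + \<theta>\<^sup>2) - \<theta> * (n\<^sup>2 * l - n) =
      l / 16 - l / (16 * n) - l / 4 + 1 / 4"
    using n by (simp add: \<theta>_def field_simps power2_eq_square)
  also have "\<dots> \<le> - l / 64"
  proof -
    have "0 \<le> l / (16 * n)" using n l by simp
    with l show ?thesis by linarith
  qed
  finally show ?thesis unfolding \<mu> .
qed

text \<open>A union bound over all queues at all round-robin slots and over the \<open>2 * n\<close>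
  lines. The exact service count is relaxed to \<open>v / n + 1\<close>, which makes the exponential
  estimate uniform over the queues.\<close>

lemma (in batched_switch) prob_bad_batch:
  fixes l r :: nat
  assumes \<rho>: "\<rho> = 1 - 1 / real n" and d: "d = n * r * l" and w: "w = (n - r) * l"
    and n: "2 \<le> n" and r: "r \<le> n" "n \<le> r\<^sup>2" "2 \<le> r" and l: "4 \<le> l"
  shows "prob {\<omega>\<in>space M. \<not> good_batch (increments \<omega>) k} \<le>
    3 * (real n)\<^sup>2 * real b * exp (- real l / 64)"
proof -
  have b: "b = n\<^sup>2 * l"
  proof -
    have "d + n * w = n * ((r + (n - r)) * l)" unfolding d w by (simp only: algebra_simps)
    then show ?thesis using r(1) by (simp add: batch_length_def power2_eq_square)
  qed
  let ?e = "exp (- real l / 64)"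
  let ?arr = "\<lambda>t i j \<omega>. real (arrivals (increments \<omega>) (k * b) t i j)"
  let ?\<theta> = "- 1 / (8 * real r)"
  let ?\<eta> = "1 / (4 * real n)"
  \<comment> \<open>The negative \<open>?\<theta>\<close> reverses the inequality: \<open>E\<close>
    is the event of too few arrivals to a queue, while \<open>L\<close> below is that of too many on
    a line.\<close>
  define E where "E q = (case q of ((i, j), v) \<Rightarrow>
    {\<omega>\<in>space M. ?\<theta> * (real v / real n + 1) \<le>
       ?\<theta> * (\<Sum>(i, j)\<in>{(i, j)}. ?arr (k * b + d + v) i j \<omega>)})" for q
  define L where "L P =
    {\<omega>\<in>space M. ?\<eta> * (real b - real n) \<le> ?\<eta> * (\<Sum>(i, j)\<in>P. ?arr (Suc k * b) i j \<omega>)}" for P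
  let ?I = "({1..n} \<times> {1..n}) \<times> {..<n * w}"
  let ?rows = "(\<lambda>i. {i} \<times> {1..n}) ` {1..n}" and ?cols = "(\<lambda>j. {1..n} \<times> {j}) ` {1..n}"
  have \<theta>: "\<bar>?\<theta>\<bar> \<le> 1" "?\<theta> < 0" using r by (auto simp: field_simps)
  have \<eta>: "\<bar>?\<eta>\<bar> \<le> 1" "0 < ?\<eta>" using n by (auto simp: field_simps)
  have E: "E q \<in> events \<and> prob (E q) \<le> ?e" if q: "q \<in> ?I" for q
  proof -
    obtain i j v where q_eq: "q = ((i, j), v)" and ij: "{(i, j)} \<subseteq> {1..n} \<times> {1..n}" and v: "v < n * w"
      using q by auto
    have "d + v \<le> b" using v by (simp add: batch_length_def)
    then have m: "real (d + v) \<le> (real n)\<^sup>2 * real l" using b by (metis of_nat_le_iff of_nat_mult of_nat_power)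
    have r': "real n \<le> (real r)\<^sup>2" using r(2) by (metis of_nat_le_iff of_nat_power)
    have "real (d + v) * ((1 - 1 / real n) / real n) * (?\<theta> + ?\<theta>\<^sup>2) - ?\<theta> * (real v / real n + 1)
        \<le> - real l / 64"
      by (rule queue_exponent) (use n r r' l m in \<open>auto simp: d\<close>)
    then have "exp (real (card {(i, j)} * (k * b + d + v - k * b)) * (\<rho> / real n) * (?\<theta> + ?\<theta>\<^sup>2)
        - ?\<theta> * (real v / real n + 1)) \<le> ?e"
      by (simp add: \<rho>)
    then show ?thesis
      using chernoff_arrivals[OF ij \<theta>(1), of "real v / real n + 1" "k * b" "k * b + d + v"]
      unfolding E_def q_eq prod.case by linarith
  qed
  have L: "L P \<in> events \<and> prob (L P) \<le> ?e" if "P \<in> ?rows \<union> ?cols" for P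
  proof -
    have P: "P \<subseteq> {1..n} \<times> {1..n}" "card P = n" using that by (auto simp: card_cartesian_product)
    have "real n * ((real n)\<^sup>2 * real l) * ((1 - 1 / real n) / real n) * (?\<eta> + ?\<eta>\<^sup>2)
        - ?\<eta> * ((real n)\<^sup>2 * real l - real n) \<le> - real l / 64"
      by (rule line_exponent) (use n l in auto)
    then have "exp (real (card P * (Suc k * b - k * b)) * (\<rho> / real n) * (?\<eta> + ?\<eta>\<^sup>2)
        - ?\<eta> * (real b - real n)) \<le> ?e"
      by (simp add: \<rho> P(2) b)
    then show ?thesis
      using chernoff_arrivals[OF P(1) \<eta>(1), of "real b - real n" "k * b" "Suc k * b"]
      unfolding L_def by linarith
  qed
  have sub: "{\<omega>\<in>space M. \<not> good_batch (increments \<omega>) k} \<subseteq>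
      (\<Union>q\<in>?I. E q) \<union> (\<Union>P\<in>?rows \<union> ?cols. L P)"
  proof
    fix \<omega> assume "\<omega> \<in> {\<omega>\<in>space M. \<not> good_batch (increments \<omega>) k}"
    then have \<omega>: "\<omega> \<in> space M" and bad: "\<not> good_batch (increments \<omega>) k" by auto
    consider (queue) i j v where "i \<in> {1..n}" "j \<in> {1..n}" "v < n * w"
        "arrivals (increments \<omega>) (k * b) (k * b + d + v) i j \<le> round_robin_count n v i j"
      | (row) i where "i \<in> {1..n}"
        "b < (\<Sum>j=1..n. arrivals (increments \<omega>) (k * b) (Suc k * b) i j) + n"
      | (col) j where "j \<in> {1..n}"
        "b < (\<Sum>i=1..n. arrivals (increments \<omega>) (k * b) (Suc k * b) i j) + n"
      using bad unfolding good_batch_def by (meson not_le_imp_less not_less)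
    then show "\<omega> \<in> (\<Union>q\<in>?I. E q) \<union> (\<Union>P\<in>?rows \<union> ?cols. L P)"
    proof cases
      case queue
      have "real (v div n) \<le> real v / real n" by (rule of_nat_div_le_of_nat)
      moreover have "arrivals (increments \<omega>) (k * b) (k * b + d + v) i j \<le> v div n + 1"
        using queue(4) round_robin_count_le[OF ports queue(1,2), of v] by linarith
      ultimately have "?arr (k * b + d + v) i j \<omega> \<le> real v / real n + 1" by linarith
      then have "?\<theta> * (real v / real n + 1) \<le> ?\<theta> * ?arr (k * b + d + v) i j \<omega>"
        using \<theta>(2) by (intro mult_left_mono_neg) auto
      then have "\<omega> \<in> E ((i, j), v)" using \<omega> by (simp add: E_def)
      moreover have "((i, j), v) \<in> ?I" using queue by simp
      ultimately show ?thesis by blast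
    next
      case row
      have "(\<Sum>(i, j)\<in>{i} \<times> {1..n}. ?arr (Suc k * b) i j \<omega>) =
          real (\<Sum>j=1..n. arrivals (increments \<omega>) (k * b) (Suc k * b) i j)"
        by (simp add: sum.cartesian_product' del: mult_Suc)
      then have "real b - real n \<le> (\<Sum>(i, j)\<in>{i} \<times> {1..n}. ?arr (Suc k * b) i j \<omega>)"
        using row(2) by linarith
      then have "\<omega> \<in> L ({i} \<times> {1..n})"
        unfolding L_def using \<omega> \<eta>(2) mult_left_mono less_imp_le by blast
      then show ?thesis using row(1) by blast
    next
      case col
      have "(\<Sum>(i, j)\<in>{1..n} \<times> {j}. ?arr (Suc k * b) i j \<omega>) =
          real (\<Sum>i=1..n. arrivals (increments \<omega>) (k * b) (Suc k * b) i j)"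
        by (simp add: sum.cartesian_product' del: mult_Suc)
      then have "real b - real n \<le> (\<Sum>(i, j)\<in>{1..n} \<times> {j}. ?arr (Suc k * b) i j \<omega>)"
        using col(2) by linarith
      then have "\<omega> \<in> L ({1..n} \<times> {j})"
        unfolding L_def using \<omega> \<eta>(2) mult_left_mono less_imp_le by blast
      then show ?thesis using col(1) by blast
    qed
  qed
  have fin: "finite ?I" "finite (?rows \<union> ?cols)" by auto
  have "prob {\<omega>\<in>space M. \<not> good_batch (increments \<omega>) k} \<le>
      prob ((\<Union>q\<in>?I. E q) \<union> (\<Union>P\<in>?rows \<union> ?cols. L P))"
    by (rule finite_measure_mono[OF sub]) (use E L fin in \<open>intro sets.Un sets.finite_UN; blast\<close>)
  also have "\<dots> \<le> prob (\<Union>q\<in>?I. E q) + prob (\<Union>P\<in>?rows \<union> ?cols. L P)"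
    by (rule measure_Un_le) (use E L fin in \<open>intro sets.finite_UN; blast\<close>)+
  also have "\<dots> \<le> (\<Sum>q\<in>?I. prob (E q)) + (\<Sum>P\<in>?rows \<union> ?cols. prob (L P))"
    using E L fin by (intro add_mono finite_measure_subadditive_finite) blast+
  also have "\<dots> \<le> (\<Sum>q\<in>?I. ?e) + (\<Sum>P\<in>?rows \<union> ?cols. ?e)"
    using E L by (intro add_mono sum_mono) blast+
  also have "\<dots> = real (card ?I + card (?rows \<union> ?cols)) * ?e" by (simp add: algebra_simps)
  \<comment> \<open>The queue events number at most \<open>n\<^sup>2 * b\<close>; the
    \<open>2 * n\<close> lines fit into two further copies of this number.\<close>
  also have "\<dots> \<le> real (3 * (n\<^sup>2 * b)) * ?e"
  proof (intro mult_right_mono of_nat_mono)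
    have "card (?rows \<union> ?cols) \<le> card ?rows + card ?cols" by (rule card_Un_le)
    also have "\<dots> \<le> n + n" by (intro add_mono order_trans[OF card_image_le]) auto
    finally have "card (?rows \<union> ?cols) \<le> 2 * n" by simp
    moreover have "card ?I = n\<^sup>2 * (n * w)" by (simp add: card_cartesian_product power2_eq_square)
    moreover have "n\<^sup>2 * (n * w) \<le> n\<^sup>2 * b" by (simp add: batch_length_def)
    moreover have "n \<le> n\<^sup>2 * b" using ports b_pos by (simp add: power2_eq_square)
    ultimately show "card ?I + card (?rows \<union> ?cols) \<le> 3 * (n\<^sup>2 * b)" by linarith
  qed simp
  finally show ?thesis by (simp add: algebra_simps)
qed

section \<open>Choice of the parameters\<close>

text \<open>The left side is \<open>9 * n\<^sup>2 * b\<^sup>2 * p\<close> for the failure bound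
  \<open>p\<close> and the batch length \<open>b = n\<^sup>2 * 4096 * m\<close>. In powers of
  \<open>exp m\<close>, the factor \<open>n ^ 10 * m ^ 3\<close> costs 13 of the available 64, and
  the other 51 absorb the numerical constant because \<open>exp m \<ge> 2\<close>.\<close>

lemma tail_bound_numeric:
  fixes n m :: nat
  assumes n: "real n \<le> exp (real m)" and m: "1 \<le> m"
  shows "27 * (real n)^4 * ((real n)\<^sup>2 * (4096 * real m)) ^ 3 * exp (- (64 * real m)) \<le> 1"
proof -
  define E where "E = exp (real m)"
  have m_E: "real m \<le> E" using exp_ge_add_one_self[of "real m"] unfolding E_def by linarith
  have E2: "2 \<le> E" using exp_ge_add_one_self[of "real m"] m unfolding E_def by linarith
  have "27 * (real n)^4 * ((real n)\<^sup>2 * (4096 * real m)) ^ 3 \<le> 27 * E^4 * (E\<^sup>2 * (4096 * E)) ^ 3"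
    using n m_E unfolding E_def by (intro mult_mono power_mono mult_nonneg_nonneg) auto
  also have "\<dots> = 27 * 4096 ^ 3 * E ^ 13"
    by (simp add: power_mult_distrib power_mult[symmetric] power_add[symmetric] flip: power_Suc)
  also have "\<dots> \<le> E ^ 51 * E ^ 13"
  proof (intro mult_right_mono)
    have "(27 * 4096 ^ 3 :: real) \<le> 2 ^ 51" by simp
    also have "\<dots> \<le> E ^ 51" using E2 by (intro power_mono) auto
    finally show "27 * 4096 ^ 3 \<le> E ^ 51" .
  qed (use E2 in simp)
  also have "\<dots> = exp (64 * real m)"
    unfolding E_def by (simp only: exp_of_nat_mult[symmetric] exp_add[symmetric]) simp
  finally have "27 * (real n)^4 * ((real n)\<^sup>2 * (4096 * real m)) ^ 3 * exp (- (64 * real m))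
      \<le> exp (64 * real m) * exp (- (64 * real m))"
    by (intro mult_right_mono) auto
  then show ?thesis by (simp add: exp_minus)
qed

lemma sqrt_ceiling:
  fixes n :: nat
  assumes "2 \<le> n"
  defines "r \<equiv> nat \<lceil>sqrt (real n)\<rceil>"
  shows "r \<le> n" "n \<le> r\<^sup>2" "2 \<le> r" "real r \<le> 2 * sqrt (real n)"
proof -
  have gt1: "1 < sqrt (real n)" using assms(1) by simp
  have r: "sqrt (real n) \<le> real r" "real r < sqrt (real n) + 1"
    using gt1 unfolding r_def by linarith+
  have "sqrt (real n) \<le> real n" by (rule real_le_lsqrt) (use assms(1) in \<open>auto simp: power2_eq_square\<close>)
  then show "r \<le> n" unfolding r_def by linarith
  show "2 \<le> r" using r(1) gt1 by linarith
  show "real r \<le> 2 * sqrt (real n)" using r gt1 by linarith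
  have "(sqrt (real n))\<^sup>2 \<le> (real r)\<^sup>2" using r(1) by (intro power_mono) auto
  then have "real n \<le> real (r\<^sup>2)" by simp
  then show "n \<le> r\<^sup>2" by (simp only: of_nat_le_iff)
qed

text \<open>Since \<open>ln n \<ge> 1 / 2\<close>, the rounding error 1 is at most
  \<open>2 * ln n\<close>; hence the factor 3.\<close>

lemma ln_ceiling:
  fixes n :: nat
  assumes "2 \<le> n"
  defines "m \<equiv> nat \<lceil>ln (real n)\<rceil>"
  shows "real n \<le> exp (real m)" "1 \<le> m" "real m \<le> 3 * ln (real n)" "1 / 2 \<le> ln (real n)"
proof -
  have "ln 2 \<le> ln (real n)" using assms(1) by simp
  then show half: "1 / 2 \<le> ln (real n)" using ln2_ge_two_thirds by linarith
  then have m: "ln (real n) \<le> real m" "real m < ln (real n) + 1" unfolding m_def by linarith+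
  show "1 \<le> m" "real m \<le> 3 * ln (real n)" using m half by linarith+
  have "real n = exp (ln (real n))" using assms(1) by simp
  also have "\<dots> \<le> exp (real m)" using m(1) by simp
  finally show "real n \<le> exp (real m)" .
qed

text \<open>Integrability is claimed along with the bound because the Bochner integral of a function
  that is not integrable is 0. The policy is fixed before the probability space and the
  arrivals.\<close>

theorem corollary3p2:
  "\<exists>c::real. \<forall>n::nat. n \<ge> 1 \<longrightarrow>
     (\<exists>\<pi>. scheduling_policy n \<pi> \<and>
        (\<forall>(M :: 'w measure) A. bernoulli_arrivals M n (1 - 1 / real n) A \<longrightarrow>
           (\<forall>\<tau>\<ge>1.
              (\<forall>i\<in>{1..n}. \<forall>j\<in>{1..n}.
                 integrable M (\<lambda>\<omega>. real (queue n \<pi> (\<lambda>k l t. A k l t \<omega>) \<tau> i j))) \<and>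
              (\<Sum>i=1..n. \<Sum>j=1..n.
                 prob_space.expectation M (\<lambda>\<omega>. real (queue n \<pi> (\<lambda>k l t. A k l t \<omega>) \<tau> i j)))
                \<le> c * real n powr 2.5 * ln (real n))))"
proof (intro exI[of _ "50000 :: real"] allI impI)
  fix n :: nat assume "1 \<le> n"
  then consider "n = 1" | "2 \<le> n" by linarith
  then show "\<exists>\<pi>. scheduling_policy n \<pi> \<and>
        (\<forall>(M :: 'w measure) A. bernoulli_arrivals M n (1 - 1 / real n) A \<longrightarrow>
           (\<forall>\<tau>\<ge>1.
              (\<forall>i\<in>{1..n}. \<forall>j\<in>{1..n}.
                 integrable M (\<lambda>\<omega>. real (queue n \<pi> (\<lambda>k l t. A k l t \<omega>) \<tau> i j))) \<and>
              (\<Sum>i=1..n. \<Sum>j=1..n.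
                 prob_space.expectation M (\<lambda>\<omega>. real (queue n \<pi> (\<lambda>k l t. A k l t \<omega>) \<tau> i j)))
                \<le> 50000 * real n powr 2.5 * ln (real n)))"
  proof cases
    \<comment> \<open>The right side vanishes because \<open>ln 1 = 0\<close>, so the mean has to be
      exactly 0. It is, since the load \<open>1 - 1 / n\<close> is 0 as well.\<close>
    case 1
    let ?\<pi> = "(\<lambda>h q i j. 0) :: policy"
    show ?thesis
    proof (rule exI[of _ ?\<pi>], intro conjI allI impI)
      show "scheduling_policy n ?\<pi>" by (simp add: scheduling_policy_def schedules_def)
    next
      fix M :: "'w measure" and A and \<tau> :: nat assume A: "bernoulli_arrivals M n (1 - 1 / real n) A" and "1 \<le> \<tau>"
      then obtain s where s: "\<tau> = Suc s" by (cases \<tau>) auto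
      interpret bernoulli_switch M n "1 - 1 / real n" A
        by unfold_locales (use A 1 in auto)
      show "\<forall>i\<in>{1..n}. \<forall>j\<in>{1..n}. integrable M (\<lambda>\<omega>. real (queue n ?\<pi> (\<lambda>k l t. A k l t \<omega>) \<tau> i j))"
        unfolding s using integrable_queue by blast
      have "expectation (\<lambda>\<omega>. real (queue n ?\<pi> (\<lambda>k l t. A k l t \<omega>) \<tau> i j)) \<le> 0"
        if "i \<in> {1..n}" "j \<in> {1..n}" for i j
      proof -
        have "expectation (\<lambda>\<omega>. real (queue n ?\<pi> (\<lambda>k l t. A k l t \<omega>) \<tau> i j)) \<le>
            expectation (\<lambda>\<omega>. real (arrivals (increments \<omega>) 0 s i j))"
          unfolding s using integrable_queue[OF that] expectation_arrivals(1)[OF that] queue_le_arrivals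
          by (intro integral_mono) (auto simp: increments_def)
        also have "\<dots> = 0" using expectation_arrivals(2)[OF that] 1 by simp
        finally show ?thesis .
      qed
      then have "(\<Sum>i=1..n. \<Sum>j=1..n. expectation (\<lambda>\<omega>. real (queue n ?\<pi> (\<lambda>k l t. A k l t \<omega>) \<tau> i j))) \<le> 0"
        by (intro sum_nonpos)
      then show "(\<Sum>i=1..n. \<Sum>j=1..n. expectation (\<lambda>\<omega>. real (queue n ?\<pi> (\<lambda>k l t. A k l t \<omega>) \<tau> i j)))
          \<le> 50000 * real n powr 2.5 * ln (real n)"
        using 1 by simp
    qed
  next
    case 2
    define m where "m = nat \<lceil>ln (real n)\<rceil>"
    define r where "r = nat \<lceil>sqrt (real n)\<rceil>"
    \<comment> \<open>4096 is 64 * 64, so the tail \<open>exp (- l / 64)\<close> becomes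
      \<open>exp (- 64 * m)\<close>, at most \<open>n\<close> to the power -64.\<close>
    define l where "l = 4096 * m"
    define d where "d = n * r * l"
    define w where "w = (n - r) * l"
    note m = ln_ceiling[OF 2, folded m_def] and r = sqrt_ceiling[OF 2, folded r_def]
    have "1 * 1 \<le> r * l" using m(2) r(3) unfolding l_def by (intro mult_le_mono) auto
    then have n_le_d: "n \<le> d" unfolding d_def mult.assoc by simp
    interpret batching n d w by unfold_locales (use 2 n_le_d in auto)
    have b: "b = n\<^sup>2 * l"
    proof -
      have "d + n * w = n * ((r + (n - r)) * l)" unfolding d_def w_def by (simp only: algebra_simps)
      then show ?thesis using r(1) by (simp add: batch_length_def power2_eq_square)
    qed
    define p where "p = 3 * (real n)\<^sup>2 * real b * exp (- real l / 64)"
    have "9 * (real n)\<^sup>2 * (real b)\<^sup>2 * p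
        = 27 * (real n)^4 * ((real n)\<^sup>2 * (4096 * real m)) ^ 3 * exp (- (64 * real m))"
      by (simp add: p_def b l_def power2_eq_square power3_eq_cube power4_eq_xxxx)
    then have p: "9 * (real n)\<^sup>2 * (real b)\<^sup>2 * p \<le> 1"
      using tail_bound_numeric[OF m(1,2)] by linarith
    have "8 * real b * p \<le> 9 * ((real n)\<^sup>2 * (real b)\<^sup>2) * p"
    proof (rule mult_right_mono)
      have "1 * real b \<le> (real n)\<^sup>2 * (real b)\<^sup>2"
        using b_pos 2 by (intro mult_mono one_le_power self_le_power) auto
      then show "8 * real b \<le> 9 * ((real n)\<^sup>2 * (real b)\<^sup>2)" by simp
    qed (simp add: p_def)
    with p have p8: "8 * real b * p \<le> 1" by simp
    \<comment> \<open>49152 is 2 * 4096 * 2 * 3, where the last two factors are the rounding losses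
      in \<open>r\<close> and \<open>m\<close>. The failure term adds at most 1, which
      \<open>small\<close> converts into 2 more units, and 49154 is below 50000.\<close>
    have nd: "2 * real n * real d \<le> 49152 * (real n powr 2.5 * ln (real n))"
    proof -
      have "real n powr 2.5 = real n powr 2 * real n powr (1 / 2)" unfolding powr_add[symmetric] by simp
      also have "\<dots> = (real n)\<^sup>2 * sqrt (real n)" using 2 by (simp add: powr_half_sqrt)
      finally have powr: "real n powr 2.5 = (real n)\<^sup>2 * sqrt (real n)" .
      have "2 * real n * real d = 8192 * (real n)\<^sup>2 * (real r * real m)"
        by (simp add: d_def l_def power2_eq_square)
      also have "\<dots> \<le> 8192 * (real n)\<^sup>2 * ((2 * sqrt (real n)) * (3 * ln (real n)))"
        using m r 2 by (intro mult_left_mono mult_mono) auto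
      finally show ?thesis unfolding powr by (simp add: mult_ac)
    qed
    have small: "1 \<le> 2 * (real n powr 2.5 * ln (real n))"
    proof -
      have "1 * (1 / 2) \<le> real n powr 2.5 * ln (real n)"
        using m(4) 2 by (intro mult_mono ge_one_powr_ge_zero) auto
      then show ?thesis by simp
    qed
    show ?thesis
    proof (rule exI[of _ batch_policy], intro conjI allI impI)
      show "scheduling_policy n batch_policy" by (rule scheduling_batch_policy)
    next
      fix M :: "'w measure" and A and \<tau> :: nat assume A: "bernoulli_arrivals M n (1 - 1 / real n) A" and "1 \<le> \<tau>"
      then obtain s where s: "\<tau> = Suc s" by (cases \<tau>) auto
      interpret batched_switch M n "1 - 1 / real n" A d w
        by unfold_locales (use A 2 in auto)
      show "\<forall>i\<in>{1..n}. \<forall>j\<in>{1..n}. integrable M (\<lambda>\<omega>. real (queue n batch_policy (\<lambda>k l t. A k l t \<omega>) \<tau> i j))"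
        unfolding s using integrable_queue by blast
      have fail: "prob {\<omega>\<in>space M. \<not> good_batch (increments \<omega>) k} \<le> p" for k
        unfolding p_def
        by (rule prob_bad_batch[OF refl d_def w_def 2 r(1-3)]) (use m(2) in \<open>simp add: l_def\<close>)
      show "(\<Sum>i=1..n. \<Sum>j=1..n. expectation (\<lambda>\<omega>. real (queue n batch_policy (\<lambda>k l t. A k l t \<omega>) \<tau> i j)))
          \<le> 50000 * real n powr 2.5 * ln (real n)"
        using expectation_total_queue[OF fail p8, of s] p nd small unfolding s by linarith
    qed
  qed
qed

end
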